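(* Let $\Omega\subset\mathbb{R}^N$ be a bounded open set, $f\in C^0(\Omega)$, and let $F,\mathcal{H}$ satisfy the assumptions in the context. Then there exists $C>0$, depending only on $N,\lambda,\Lambda,p,q,L_1,\mathrm{diam}(\Omega)$, such that any $u\in C^0(\overline{\Omega})$ which is a viscosity sub-solution (resp. super-solution) of $\mathcal{H}(x,\nabla u)F(x,D^2u)=f(x)$ in $\{x\in\Omega:u(x)>0\}$ (resp. $\{x\in\Omega:u(x)<0\}$) satisfies $$\sup_\Omega u\le\sup_{\partial\Omega}u^++C\,\mathrm{diam}(\Omega)\max\left\{\left\|\tfrac{f^-}{1+\mathfrak{a}}\right\|^{\frac1{p+1}}_{L^N(\Gamma^+(u^+))},\left\|\tfrac{f^-}{1+\mathfrak{a}}\right\|^{\frac1{q+1}}_{L^N(\Gamma^+(u^+))}\right\}$$ $$\left(\text{resp. }\ \sup_\Omega u^-\le\sup_{\partial\Omega}u^-+C\,\mathrm{diam}(\Omega)\max\left\{\left\|\tfrac{f^+}{1+\mathfrak{a}}\right\|^{\frac1{p+1}}_{L^N(\Gamma^+(u^-))},\left\|\tfrac{f^+}{1+\mathfrak{a}}\right\|^{\frac1{q+1}}_{L^N(\Gamma^+(u^-))}\right\}\right),$$ where $\Gamma^+(u):=\{x\in\Omega:\exists\,\xi\in\mathbb{R}^N\text{ with }u(y)\le u(x)+\langle\xi,y-x\rangle\ \forall y\in\Omega\}$. In particular, for viscosity solutions $u$, $$\|u\|_{L^\infty(\Omega)}\le\|u\|_{L^\infty(\partial\Omega)}+C\,\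mathrm{diam}(\Omega)\max\left\{\left\|\tfrac{f}{1+\mathfrak{a}}\right\|^{\frac1{p+1}}_{L^N(\Omega)},\left\|\tfrac{f}{1+\mathfrak{a}}\right\|^{\frac1{q+1}}_{L^N(\Omega)}\right\}.$$
   Context: $u^\pm,f^\pm$ denote positive and negative parts (both non-negative). $\mathrm{Sym}(N)$ is the space of real symmetric $N\times N$ matrices, $0<\lambda\le\Lambda<\infty$, $\mathscr{M}^{-}_{\lambda,\Lambda}(X)=\lambda\sum_{e_i>0}e_i+\Lambda\sum_{e_i<0}e_i$, $\mathscr{M}^{+}_{\lambda,\Lambda}(X)=\Lambda\sum_{e_i>0}e_i+\lambda\sum_{e_i<0}e_i$, with $e_i$ the eigenvalues of $X$. Assumptions. $F:\Omega\times\mathrm{Sym}(N)\to\mathbb{R}$ satisfies: for each $x$, $F(x,\cdot)$ is continuous and $F(x,0)=0$; $\mathscr{M}^-_{\lambda,\Lambda}(X-Y)\le F(x,X)-F(x,Y)\le\mathscr{M}^+_{\lambda,\Lambda}(X-Y)$ for all $X,Y$; and there are a modulus of continuity $\omega$ and $C_F>0$ with $\sup_{X\neq0}\frac{|F(x,X)-F(x_0,X)|}{\|X\|}\le C_F\,\omega(|x-x_0|)$. $\mathcal{H}:\Omega\times\mathbb{R}^N\to[0,\infty)$ satisfies $L_1(|\xi|^p+\mathfrak{a}(x)|\xi|^q)\le\mathcal{H}(x,\xi)\le L_2(|\xi|^p+\mathfrak{a}(x)|\xi|^q)$ with $0<L_1\le L_2<\infty$, $0<p\le q<\infty$, $\mathfrak{a}\in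 C^0(\Omega,[0,\infty))$. Viscosity solutions. $u$ is a viscosity sub-solution (super-solution) of $\mathcal{H}(x,\nabla u)F(x,D^2u)=f(x)$ in an open set $U$ if whenever $\phi\in C^2(U)$ and $u-\phi$ has a local maximum (minimum) at $x_0\in U$, one has $\mathcal{H}(x_0,\nabla\phi(x_0))F(x_0,D^2\phi(x_0))\ge f(x_0)$ (resp. $\le$). A solution is both. *)

theory Defs
  imports "HOL-Analysis.Analysis"
begin

definition pos_part :: "('a \<Rightarrow> real) \<Rightarrow> 'a \<Rightarrow> real" where
  "pos_part u x = max (u x) 0"

definition neg_part :: "('a \<Rightarrow> real) \<Rightarrow> 'a \<Rightarrow> real" where
  "neg_part u x = max (- u x) 0"

definition Sym :: "(real^'n^'n) set" where
  "Sym = {X. transpose X = X}"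

definition eigenspace :: "real^'n^'n \<Rightarrow> real \<Rightarrow> (real^'n) set" where
  "eigenspace X e = {v. X *v v = e *\<^sub>R v}"

definition eigenvalues :: "real^'n^'n \<Rightarrow> real set" where
  "eigenvalues X = {e. \<exists>v. v \<noteq> 0 \<and> X *v v = e *\<^sub>R v}"

text \<open>
  The eigenvalues are repeated according to multiplicity. Both operators are only ever applied
  to symmetric matrices, for which the multiplicity of an eigenvalue is the dimension of its
  eigenspace.
\<close>

definition pucci_min :: "real \<Rightarrow> real \<Rightarrow> real^'n^'n \<Rightarrow> real" where
  "pucci_min lam Lam X =
     lam * (\<Sum>e | e \<in> eigenvalues X \<and> e > 0. real (dim (eigenspace X e)) * e)
   + Lam * (\<Sum>e | e \<in> eigenvalues X \<and> e < 0. real (dim (eigenspace X e)) * e)"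

definition pucci_max :: "real \<Rightarrow> real \<Rightarrow> real^'n^'n \<Rightarrow> real" where
  "pucci_max lam Lam X =
     Lam * (\<Sum>e | e \<in> eigenvalues X \<and> e > 0. real (dim (eigenspace X e)) * e)
   + lam * (\<Sum>e | e \<in> eigenvalues X \<and> e < 0. real (dim (eigenspace X e)) * e)"

definition modulus_of_continuity :: "(real \<Rightarrow> real) \<Rightarrow> bool" where
  "modulus_of_continuity \<omega> \<longleftrightarrow>
     (\<forall>t\<ge>0. \<omega> t \<ge> 0) \<and> mono_on {0..} \<omega> \<and> \<omega> 0 = 0 \<and> (\<omega> \<longlongrightarrow> 0) (at_right 0)"

text \<open>
  Only the values of \<open>F\<close> at points of \<open>\<Omega>\<close> and at symmetric matrices are constrained. The norm
  on matrices is the Euclidean (Frobenius) one; another norm only changes \<open>CF\<close>.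
\<close>

definition F_assumptions ::
  "real \<Rightarrow> real \<Rightarrow> (real^'n) set \<Rightarrow> (real^'n \<Rightarrow> real^'n^'n \<Rightarrow> real) \<Rightarrow> bool" where
  "F_assumptions lam Lam \<Omega> F \<longleftrightarrow>
     (\<forall>x\<in>\<Omega>. continuous_on Sym (F x) \<and> F x 0 = 0) \<and>
     (\<forall>x\<in>\<Omega>. \<forall>X\<in>Sym. \<forall>Y\<in>Sym.
        pucci_min lam Lam (X - Y) \<le> F x X - F x Y \<and>
        F x X - F x Y \<le> pucci_max lam Lam (X - Y)) \<and>
     (\<exists>\<omega> CF. modulus_of_continuity \<omega> \<and> CF > 0 \<and>
        (\<forall>x\<in>\<Omega>. \<forall>x0\<in>\<Omega>. \<forall>X\<in>Sym. X \<noteq> 0 \<longrightarrow>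
           \<bar>F x X - F x0 X\<bar> / norm X \<le> CF * \<omega> (norm (x - x0))))"

definition H_assumptions ::
  "real \<Rightarrow> real \<Rightarrow> real \<Rightarrow> real \<Rightarrow> (real^'n \<Rightarrow> real) \<Rightarrow> (real^'n) set
     \<Rightarrow> (real^'n \<Rightarrow> real^'n \<Rightarrow> real) \<Rightarrow> bool" where
  "H_assumptions p q L1 L2 a \<Omega> H \<longleftrightarrow>
     0 < L1 \<and> L1 \<le> L2 \<and> 0 < p \<and> p \<le> q \<and>
     continuous_on \<Omega> a \<and> (\<forall>x\<in>\<Omega>. a x \<ge> 0) \<and>
     (\<forall>x\<in>\<Omega>. \<forall>\<xi>. H x \<xi> \<ge> 0 \<and>
        L1 * (norm \<xi> powr p + a x * norm \<xi> powr q) \<le> H x \<xi> \<and>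
        H x \<xi> \<le> L2 * (norm \<xi> powr p + a x * norm \<xi> powr q))"

definition grad :: "(real^'n \<Rightarrow> real) \<Rightarrow> real^'n \<Rightarrow> real^'n" where
  "grad \<phi> x = (\<chi> i. frechet_derivative \<phi> (at x) (axis i 1))"

definition hess :: "(real^'n \<Rightarrow> real) \<Rightarrow> real^'n \<Rightarrow> real^'n^'n" where
  "hess \<phi> x = matrix (frechet_derivative (grad \<phi>) (at x))"

definition C2_on :: "(real^'n) set \<Rightarrow> (real^'n \<Rightarrow> real) \<Rightarrow> bool" where
  "C2_on U \<phi> \<longleftrightarrow>
     (\<forall>x\<in>U. \<phi> differentiable (at x) \<and> grad \<phi> differentiable (at x)) \<and>
     continuous_on U (hess \<phi>)"

text \<open>
  The set \<open>U\<close> is meant to be open, so that neighbourhoods of a point in \<open>U\<close> and in the whole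
  space agree, and values of \<open>u\<close> and \<open>\<phi>\<close> outside \<open>U\<close> are irrelevant.
\<close>

definition local_max_at :: "(real^'n \<Rightarrow> real) \<Rightarrow> real^'n \<Rightarrow> bool" where
  "local_max_at g x0 \<longleftrightarrow> (\<forall>\<^sub>F x in nhds x0. g x \<le> g x0)"

definition local_min_at :: "(real^'n \<Rightarrow> real) \<Rightarrow> real^'n \<Rightarrow> bool" where
  "local_min_at g x0 \<longleftrightarrow> (\<forall>\<^sub>F x in nhds x0. g x0 \<le> g x)"

definition viscosity_subsolution ::
  "(real^'n \<Rightarrow> real^'n \<Rightarrow> real) \<Rightarrow> (real^'n \<Rightarrow> real^'n^'n \<Rightarrow> real) \<Rightarrow> (real^'n \<Rightarrow> real)
     \<Rightarrow> (real^'n) set \<Rightarrow> (real^'n \<Rightarrow> real) \<Rightarrow> bool" where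
  "viscosity_subsolution H F f U u \<longleftrightarrow>
     (\<forall>\<phi> x0. C2_on U \<phi> \<and> x0 \<in> U \<and> local_max_at (\<lambda>x. u x - \<phi> x) x0 \<longrightarrow>
        H x0 (grad \<phi> x0) * F x0 (hess \<phi> x0) \<ge> f x0)"

definition viscosity_supersolution ::
  "(real^'n \<Rightarrow> real^'n \<Rightarrow> real) \<Rightarrow> (real^'n \<Rightarrow> real^'n^'n \<Rightarrow> real) \<Rightarrow> (real^'n \<Rightarrow> real)
     \<Rightarrow> (real^'n) set \<Rightarrow> (real^'n \<Rightarrow> real) \<Rightarrow> bool" where
  "viscosity_supersolution H F f U u \<longleftrightarrow>
     (\<forall>\<phi> x0. C2_on U \<phi> \<and> x0 \<in> U \<and> local_min_at (\<lambda>x. u x - \<phi> x) x0 \<longrightarrow>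
        H x0 (grad \<phi> x0) * F x0 (hess \<phi> x0) \<le> f x0)"

definition viscosity_solution ::
  "(real^'n \<Rightarrow> real^'n \<Rightarrow> real) \<Rightarrow> (real^'n \<Rightarrow> real^'n^'n \<Rightarrow> real) \<Rightarrow> (real^'n \<Rightarrow> real)
     \<Rightarrow> (real^'n) set \<Rightarrow> (real^'n \<Rightarrow> real) \<Rightarrow> bool" where
  "viscosity_solution H F f U u \<longleftrightarrow>
     viscosity_subsolution H F f U u \<and> viscosity_supersolution H F f U u"

definition upper_contact_set :: "(real^'n) set \<Rightarrow> (real^'n \<Rightarrow> real) \<Rightarrow> (real^'n) set" where
  "upper_contact_set \<Omega> u = {x\<in>\<Omega>. \<exists>\<xi>. \<forall>y\<in>\<Omega>. u y \<le> u x + \<xi> \<bullet> (y - x)}"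

text \<open>
  Real powers of extended nonnegative reals, for positive exponents. The right-hand side \<open>f\<close> is
  merely continuous on the open set \<open>\<Omega>\<close>, so the \<open>L\<^sup>N\<close> norms may be infinite.
\<close>

definition epowr :: "ennreal \<Rightarrow> real \<Rightarrow> ennreal" where
  "epowr z r = (if z = \<infinity> then \<infinity> else ennreal (enn2real z powr r))"

definition LN_norm :: "(real^'n) set \<Rightarrow> (real^'n \<Rightarrow> real) \<Rightarrow> ennreal" where
  "LN_norm A g =
     epowr (\<integral>\<^sup>+x\<in>A. ennreal (\<bar>g x\<bar> ^ CARD('n)) \<partial>lebesgue) (1 / real CARD('n))"

definition rhs_term ::
  "real \<Rightarrow> real \<Rightarrow> (real^'n) set \<Rightarrow> (real^'n \<Rightarrow> real) \<Rightarrow> ereal" where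
  "rhs_term p q A g =
     enn2ereal (max (epowr (LN_norm A g) (1 / (p + 1))) (epowr (LN_norm A g) (1 / (q + 1))))"

end

theory Submission
  imports Defs
begin

text \<open>
  The proof compares the volume of a ball of slopes with an integral over the contact set.
  Let \<open>m\<close> bound \<open>u\<close> on the boundary and let \<open>u x0 > m + 4 \<kappa> diam \<Omega>\<close>. Every slope \<open>\<xi>\<close> with
  \<open>\<bar>\<xi>\<bar> \<le> 4 \<kappa>\<close> is then the slope of a plane that touches \<open>u\<close> from above at an interior maximum
  point of \<open>u y - \<xi> \<bullet> y\<close>, and such points are contact points at which \<open>u\<close> is positive. If, up to a
  constant, the slopes used at contact points of a small cube \<open>Q\<close> fill a volume at most
  \<open>\<bar>Q\<bar> G\<^sup>N / min (\<kappa>\<^sup>p) (\<kappa>\<^sup>q)\<^sup>N\<close> with \<open>G = f\<^sup>- / (1 + a)\<close>, then summation over cubes gives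
  \<open>\<kappa> min (\<kappa>\<^sup>p) (\<kappa>\<^sup>q) \<le> const \<parallel>G\<parallel>\<close> in \<open>L\<^sup>N\<close> of the contact set. Solving for \<open>\<kappa>\<close> produces the two
  exponents \<open>1 / (p + 1)\<close> and \<open>1 / (q + 1)\<close>.

  The classical route to the estimate on cubes shows that the concave envelope is \<open>C\<^sup>1\<^sup>,\<^sup>1\<close> and applies
  the area formula. Since constants do not matter, a direct argument suffices
  (\<open>barrier_slope_bound\<close>): if two contact points at distance at most \<open>r\<close> had slopes differing by more than
  \<open>t\<close>, then \<open>u\<close> would lie below a plane at one of them and drop off at rate \<open>t\<close> in some direction
  \<open>e\<close>. A quadratic polynomial that bends down along \<open>e\<close> and slightly up across \<open>e\<close> can be pushed
  against \<open>u\<close> in a box of size comparable to \<open>r\<close>. Its Pucci value is at most \<open>- lam t / (8 r)\<close>, so the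
  equation forces \<open>t / r \<le> const G\<close> somewhere in the box. Hence the slopes from a cube of edge \<open>h\<close>
  lie in one ball of radius comparable to \<open>h G\<close>. The degeneracy of \<open>H\<close> is harmless because only slopes of size at least
  \<open>2 \<kappa>\<close> are used, and for a small cube the gradient of the plane plus the quadratic polynomial
  is at least \<open>\<kappa>\<close> in norm.

  The passage from cubes to the integral is \<open>emeasure_le_integral_of_cubewise_bound\<close>, and
  \<open>contact_slopes_volume_bound\<close> combines it with the barrier. All test functions are
  quadratic polynomials, hence of class \<open>C\<^sup>2\<close> on the whole space; for this reason a solution in
  \<open>\<Omega>\<close> may be tested in \<open>{u > 0}\<close> and \<open>{u < 0}\<close> alike. Super-solutions are reduced to
  sub-solutions by passing from \<open>u\<close> to \<open>- u\<close>, which exchanges the two Pucci operators.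
\<close>

section \<open>Covering a measure estimate by small cubes\<close>

lemma borel_measurable_indicator_times_ennreal:
  fixes g :: "'a::euclidean_space \<Rightarrow> real"
  assumes "compact K" "continuous_on K g"
  shows "(\<lambda>y. indicator K y * ennreal (g y)) \<in> borel_measurable lebesgue"
proof -
  have "(\<lambda>y. indicator K y *\<^sub>R g y) \<in> borel_measurable borel"
    using compact_imp_closed[OF assms(1)]
    by (intro borel_measurable_continuous_on_indicator assms) auto
  then have "(\<lambda>y. ennreal (indicator K y *\<^sub>R g y)) \<in> borel_measurable lebesgue"
    by (intro measurable_compose[OF _ measurable_ennreal] measurable_completion) simp
  moreover have "(\<lambda>y. ennreal (indicator K y *\<^sub>R g y)) = (\<lambda>y. indicator K y * ennreal (g y))"
    by (auto simp: indicator_def)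
  ultimately show ?thesis by simp
qed

text \<open>
  A set of slopes \<open>S\<close> attached to the points of \<open>K\<close> is controlled by the integral of \<open>\<Theta>\<close> as soon
  as the slopes attached to any small cube are controlled by \<open>\<Theta>\<close> times the volume of the cube.
  The scale at which a cube counts as small may depend on the point, so the cubes come from
  the dyadic covering adapted to a gauge. They may stick out of \<open>K\<close>; confining them to
  an open set \<open>W\<close> with \<open>W - K\<close> of small measure makes that contribution negligible.
\<close>

lemma emeasure_le_integral_of_cubewise_bound:
  fixes K :: "'a::euclidean_space set" and \<Theta> :: "'a \<Rightarrow> real"
    and A :: "'a \<Rightarrow> 'b::euclidean_space set"
  assumes K: "compact K" and cont: "continuous_on K \<Theta>" and nonneg: "\<And>x. x \<in> K \<Longrightarrow> 0 \<le> \<Theta> x"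
    and S: "S \<subseteq> (\<Union>x\<in>K. A x)"
    and loc: "\<And>x \<epsilon>. x \<in> K \<Longrightarrow> \<epsilon> > 0 \<Longrightarrow> \<exists>\<delta>>0. \<forall>c h. h > 0 \<longrightarrow> x \<in> cbox c (c + h *\<^sub>R One) \<longrightarrow>
          cbox c (c + h *\<^sub>R One) \<subseteq> ball x \<delta> \<longrightarrow>
          (\<exists>B\<in>sets lebesgue. (\<Union>y\<in>K \<inter> cbox c (c + h *\<^sub>R One). A y) \<subseteq> B \<and>
             emeasure lebesgue B \<le> ennreal ((\<Theta> x + \<epsilon>) * h ^ DIM('a)))"
  shows "emeasure lebesgue S \<le> (\<integral>\<^sup>+x\<in>K. ennreal (\<Theta> x) \<partial>lebesgue)"
proof (rule ennreal_le_epsilon)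
  fix e :: real assume "e > 0"
  have Ks: "K \<in> sets lebesgue" and Kfin: "emeasure lebesgue K < \<infinity>"
    using lmeasurable_compact[OF K] by (auto simp: fmeasurable_def)
  obtain M where M: "M > 0" "\<And>x. x \<in> K \<Longrightarrow> \<Theta> x \<le> M"
    using compact_imp_bounded[OF compact_continuous_image[OF cont K]]
    by (auto simp: bounded_pos image_iff) (metis abs_le_D1)
  define k where "k = measure lebesgue K"
  have k: "emeasure lebesgue K = ennreal k" "k \<ge> 0"
    using Kfin by (auto simp: k_def emeasure_eq_ennreal_measure)
  define \<epsilon> where "\<epsilon> = min 1 (e / (4 * (k + 1)))"
  have \<epsilon>: "\<epsilon> > 0" "\<epsilon> \<le> 1" "2 * \<epsilon> * k \<le> e / 2"
  proof -
    show "\<epsilon> > 0" "\<epsilon> \<le> 1" using \<open>e > 0\<close> k by (auto simp: \<epsilon>_def)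
    have "2 * \<epsilon> * k \<le> 2 * (e / (4 * (k + 1))) * k"
      using k by (intro mult_right_mono mult_left_mono) (auto simp: \<epsilon>_def)
    also have "\<dots> \<le> e / 2" using k \<open>e > 0\<close> by (simp add: field_simps)
    finally show "2 * \<epsilon> * k \<le> e / 2" .
  qed
  have "e / (2 * (M + 1)) > 0" using M \<open>e > 0\<close> by simp
  then obtain W where W: "open W" "K \<subseteq> W" "W - K \<in> lmeasurable"
      "emeasure lebesgue (W - K) < ennreal (e / (2 * (M + 1)))"
    using sets_lebesgue_outer_open[OF Ks] by blast
  have "\<exists>\<delta>>0. ball x \<delta> \<subseteq> W \<and> (\<forall>y\<in>K \<inter> ball x \<delta>. \<bar>\<Theta> y - \<Theta> x\<bar> < \<epsilon>) \<and>
      (\<forall>c h. h > 0 \<longrightarrow> x \<in> cbox c (c + h *\<^sub>R One) \<longrightarrow> cbox c (c + h *\<^sub>R One) \<subseteq> ball x \<delta> \<longrightarrow>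
          (\<exists>B\<in>sets lebesgue. (\<Union>y\<in>K \<inter> cbox c (c + h *\<^sub>R One). A y) \<subseteq> B \<and>
             emeasure lebesgue B \<le> ennreal ((\<Theta> x + \<epsilon>) * h ^ DIM('a))))" if x: "x \<in> K" for x
  proof -
    obtain d1 where d1: "d1 > 0" "ball x d1 \<subseteq> W" using W x by (meson openE subsetD)
    obtain d2 where d2: "d2 > 0" "\<And>y. y \<in> K \<Longrightarrow> dist y x < d2 \<Longrightarrow> dist (\<Theta> y) (\<Theta> x) < \<epsilon>"
      using cont x \<epsilon>(1) unfolding continuous_on_iff by meson
    obtain d3 where d3: "d3 > 0" "\<forall>c h. h > 0 \<longrightarrow> x \<in> cbox c (c + h *\<^sub>R One) \<longrightarrow>
          cbox c (c + h *\<^sub>R One) \<subseteq> ball x d3 \<longrightarrow>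
          (\<exists>B\<in>sets lebesgue. (\<Union>y\<in>K \<inter> cbox c (c + h *\<^sub>R One). A y) \<subseteq> B \<and>
             emeasure lebesgue B \<le> ennreal ((\<Theta> x + \<epsilon>) * h ^ DIM('a)))"
      using loc[OF x \<epsilon>(1)] by blast
    have sub: "ball x (min d1 (min d2 d3)) \<subseteq> ball x d1" "ball x (min d1 (min d2 d3)) \<subseteq> ball x d2"
      "ball x (min d1 (min d2 d3)) \<subseteq> ball x d3" by auto
    show ?thesis
    proof (intro exI[of _ "min d1 (min d2 d3)"] conjI ballI)
      show "\<bar>\<Theta> y - \<Theta> x\<bar> < \<epsilon>" if "y \<in> K \<inter> ball x (min d1 (min d2 d3))" for y
        using d2(2)[of y] that by (auto simp: dist_commute dist_real_def)
      show "ball x (min d1 (min d2 d3)) \<subseteq> W" using sub d1 by blast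
      show "\<forall>c h. h > 0 \<longrightarrow> x \<in> cbox c (c + h *\<^sub>R One) \<longrightarrow>
          cbox c (c + h *\<^sub>R One) \<subseteq> ball x (min d1 (min d2 d3)) \<longrightarrow>
          (\<exists>B\<in>sets lebesgue. (\<Union>y\<in>K \<inter> cbox c (c + h *\<^sub>R One). A y) \<subseteq> B \<and>
             emeasure lebesgue B \<le> ennreal ((\<Theta> x + \<epsilon>) * h ^ DIM('a)))"
        using d3(2) sub(3) by (meson order_trans)
    qed (use d1 d2 d3 in auto)
  qed
  then obtain \<delta> where "\<forall>x\<in>K. \<delta> x > 0 \<and> ball x (\<delta> x) \<subseteq> W \<and> (\<forall>y\<in>K \<inter> ball x (\<delta> x). \<bar>\<Theta> y - \<Theta> x\<bar> < \<epsilon>) \<and>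
      (\<forall>c h. h > 0 \<longrightarrow> x \<in> cbox c (c + h *\<^sub>R One) \<longrightarrow> cbox c (c + h *\<^sub>R One) \<subseteq> ball x (\<delta> x) \<longrightarrow>
          (\<exists>B\<in>sets lebesgue. (\<Union>y\<in>K \<inter> cbox c (c + h *\<^sub>R One). A y) \<subseteq> B \<and>
             emeasure lebesgue B \<le> ennreal ((\<Theta> x + \<epsilon>) * h ^ DIM('a))))"
    by (rule bchoice[OF ballI, THEN exE])
  then have \<delta>: "\<And>x. x \<in> K \<Longrightarrow> \<delta> x > 0" "\<And>x. x \<in> K \<Longrightarrow> ball x (\<delta> x) \<subseteq> W"
      "\<And>x y. x \<in> K \<Longrightarrow> y \<in> K \<Longrightarrow> y \<in> ball x (\<delta> x) \<Longrightarrow> \<bar>\<Theta> y - \<Theta> x\<bar> < \<epsilon>"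
      "\<And>x c h. x \<in> K \<Longrightarrow> h > 0 \<Longrightarrow> x \<in> cbox c (c + h *\<^sub>R One) \<Longrightarrow>
          cbox c (c + h *\<^sub>R One) \<subseteq> ball x (\<delta> x) \<Longrightarrow>
          (\<exists>B\<in>sets lebesgue. (\<Union>y\<in>K \<inter> cbox c (c + h *\<^sub>R One). A y) \<subseteq> B \<and>
             emeasure lebesgue B \<le> ennreal ((\<Theta> x + \<epsilon>) * h ^ DIM('a)))"
    by (blast, blast, blast, blast)
  define g where "g x = ball x (if x \<in> K then \<delta> x else 1)" for x
  have "gauge g" using \<delta>(1) by (auto simp: gauge_def g_def)
  obtain R where R: "R > 0" "K \<subseteq> cball 0 R"
    using compact_imp_bounded[OF K] unfolding bounded_pos by (metis mem_cball_0 subsetI)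
  have Kbox: "K \<subseteq> cbox (- R *\<^sub>R One) (R *\<^sub>R One)"
  proof
    fix x assume "x \<in> K"
    then have "norm x \<le> R" using R by auto
    then have "\<bar>x \<bullet> i\<bar> \<le> R" if "i \<in> Basis" for i
      using Basis_le_norm[OF that, of x] by linarith
    then show "x \<in> cbox (- R *\<^sub>R One) (R *\<^sub>R One)" by (force simp: mem_box abs_le_iff)
  qed
  have "box (- R *\<^sub>R One) (R *\<^sub>R One :: 'a) \<noteq> {}" using R by (simp add: box_ne_empty)
  then obtain \<D> where D: "countable \<D>"
      "\<And>Q. Q \<in> \<D> \<Longrightarrow> interior Q \<noteq> {} \<and> (\<exists>c d. Q = cbox c d)"
      "pairwise (\<lambda>A B. interior A \<inter> interior B = {}) \<D>"
      "\<And>Q. Q \<in> \<D> \<Longrightarrow> \<exists>x \<in> K \<inter> Q. Q \<subseteq> g x"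
      "\<And>u v. cbox u v \<in> \<D> \<Longrightarrow> \<exists>n. \<forall>i \<in> Basis. v \<bullet> i - u \<bullet> i = (R *\<^sub>R One \<bullet> i - (- R *\<^sub>R One) \<bullet> i) / 2^n"
      "K \<subseteq> \<Union>\<D>"
    using covering_lemma[OF Kbox _ \<open>gauge g\<close>] by metis
  \<comment> \<open>On a cube \<open>Q\<close> of the covering, \<open>dens\<close> dominates the constant \<open>\<Theta> x + \<epsilon>\<close>, \<open>x\<close> being the point with \<open>Q \<subseteq> g x\<close>: by continuity of \<open>\<Theta>\<close> at points of \<open>K\<close>, and by the bound \<open>M\<close> elsewhere.\<close>
  define dens where "dens y = indicator K y * ennreal (\<Theta> y + 2 * \<epsilon>) + indicator (W - K) y * ennreal (M + 1)" for y
  have meas\<Theta>: "(\<lambda>y. indicator K y * ennreal (\<Theta> y + b)) \<in> borel_measurable lebesgue" for b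
    by (intro borel_measurable_indicator_times_ennreal K continuous_intros cont)
  have WKs: "W - K \<in> sets lebesgue" using W(3) by (rule fmeasurableD)
  have measdens: "dens \<in> borel_measurable lebesgue"
    unfolding dens_def using WKs by (intro borel_measurable_add meas\<Theta>) simp
  define \<mu> where "\<mu> = density lebesgue dens"
  have sets\<mu>: "sets \<mu> = sets lebesgue" by (simp add: \<mu>_def)
  have cube: "\<exists>B\<in>sets lebesgue. (\<Union>y\<in>K \<inter> Q. A y) \<subseteq> B \<and> emeasure lebesgue B \<le> emeasure \<mu> (interior Q)"
    if Q: "Q \<in> \<D>" for Q
  proof -
    obtain c d where cd: "Q = cbox c d" using D(2)[OF Q] by auto
    obtain n where n: "\<And>i. i \<in> Basis \<Longrightarrow> d \<bullet> i - c \<bullet> i = 2 * R / 2^n"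
      using D(5)[of c d] Q cd by auto
    define h where "h = 2 * R / 2^n"
    have h: "h > 0" using R by (simp add: h_def)
    have d: "d = c + h *\<^sub>R One"
    proof (rule euclidean_eqI)
      fix i :: 'a assume "i \<in> Basis"
      then show "d \<bullet> i = (c + h *\<^sub>R One) \<bullet> i" using n[of i] by (simp add: h_def inner_add_left algebra_simps)
    qed
    obtain x where x: "x \<in> K" "x \<in> Q" "Q \<subseteq> ball x (\<delta> x)"
      using D(4)[OF Q] by (auto simp: g_def)
    obtain B where B: "B \<in> sets lebesgue" "(\<Union>y\<in>K \<inter> Q. A y) \<subseteq> B"
        "emeasure lebesgue B \<le> ennreal ((\<Theta> x + \<epsilon>) * h ^ DIM('a))"
      using \<delta>(4)[OF x(1) h] x cd d by metis
    have intQ: "interior Q = box c (c + h *\<^sub>R One)" by (simp add: cd d)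
    have "emeasure lborel (box c (c + h *\<^sub>R One)) = ennreal (\<Prod>b\<in>(Basis::'a set). h)"
      using h by (subst emeasure_lborel_box) (auto simp: inner_add_left)
    then have vol: "emeasure lebesgue (interior Q) = ennreal (h ^ DIM('a))"
      by (simp add: intQ)
    have "ennreal ((\<Theta> x + \<epsilon>) * h ^ DIM('a)) = ennreal (\<Theta> x + \<epsilon>) * emeasure lebesgue (interior Q)"
      unfolding vol using h \<epsilon> nonneg[OF x(1)] by (intro ennreal_mult) auto
    also have "\<dots> = (\<integral>\<^sup>+y. ennreal (\<Theta> x + \<epsilon>) * indicator (interior Q) y \<partial>lebesgue)"
      by (rule nn_integral_cmult_indicator[symmetric]) (simp add: intQ)
    also have "\<dots> \<le> (\<integral>\<^sup>+y. dens y * indicator (interior Q) y \<partial>lebesgue)"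
    proof (rule nn_integral_mono)
      fix y
      show "ennreal (\<Theta> x + \<epsilon>) * indicator (interior Q) y \<le> dens y * indicator (interior Q) y"
      proof (cases "y \<in> interior Q")
        case True
        then have yb: "y \<in> ball x (\<delta> x)" using x(3) interior_subset by blast
        then have yW: "y \<in> W" using \<delta>(2)[OF x(1)] by blast
        show ?thesis
        proof (cases "y \<in> K")
          case yK: True
          have "\<Theta> x + \<epsilon> \<le> \<Theta> y + 2 * \<epsilon>" using \<delta>(3)[OF x(1) yK yb] by linarith
          then show ?thesis using yK True by (simp add: dens_def ennreal_leI)
        next
          case False
          have "\<Theta> x + \<epsilon> \<le> M + 1" using M(2)[OF x(1)] \<epsilon> by linarith
          then show ?thesis using False yW True by (simp add: dens_def ennreal_leI)
        qed
      qed simp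
    qed
    also have "\<dots> = emeasure \<mu> (interior Q)"
      unfolding \<mu>_def by (rule emeasure_density[OF measdens, symmetric]) (simp add: intQ)
    finally show ?thesis using B by (meson order_trans)
  qed
  then obtain B where B: "\<And>Q. Q \<in> \<D> \<Longrightarrow> B Q \<in> sets lebesgue"
      "\<And>Q. Q \<in> \<D> \<Longrightarrow> (\<Union>y\<in>K \<inter> Q. A y) \<subseteq> B Q"
      "\<And>Q. Q \<in> \<D> \<Longrightarrow> emeasure lebesgue (B Q) \<le> emeasure \<mu> (interior Q)"
    by metis
  define num where "num = to_nat_on \<D>"
  have num: "inj_on num \<D>" unfolding num_def by (rule inj_on_to_nat_on[OF D(1)])
  \<comment> \<open>Enumerate the cubes. Their interiors are disjoint, so that the bounds add up to at most \<open>\<mu>\<close> of the whole space.\<close>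
  define idx where "idx n = {Q\<in>\<D>. num Q = n}" for n
  define P where "P n = (\<Union>Q\<in>idx n. interior Q)" for n
  define C where "C n = (\<Union>Q\<in>idx n. B Q)" for n
  have pick: "(\<exists>Q\<in>\<D>. idx n = {Q}) \<or> idx n = {}" for n
  proof (cases "\<exists>Q\<in>\<D>. num Q = n")
    case True
    then obtain Q where "Q \<in> \<D>" "num Q = n" by blast
    moreover then have "idx n = {Q}" using num by (auto simp: idx_def dest: inj_onD)
    ultimately show ?thesis by blast
  qed (auto simp: idx_def)
  have Pmeas: "P n \<in> sets \<mu>" for n
  proof -
    have "open (P n)" by (auto simp: P_def)
    then show ?thesis by (simp add: sets\<mu> sets_completionI_sets)
  qed
  have Cmeas: "C n \<in> sets lebesgue" for n
    using pick[of n] B(1) by (auto simp: C_def)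
  have CP: "emeasure lebesgue (C n) \<le> emeasure \<mu> (P n)" for n
    using pick[of n] B(3) by (auto simp: C_def P_def)
  have disj: "disjoint_family P"
    unfolding disjoint_family_on_def
  proof (intro ballI impI)
    fix m n :: nat assume "m \<noteq> n"
    have "interior Q \<inter> interior Q' = {}" if "Q \<in> \<D>" "Q' \<in> \<D>" "num Q = m" "num Q' = n" for Q Q'
      using D(3) that \<open>m \<noteq> n\<close> unfolding pairwise_def by metis
    then show "P m \<inter> P n = {}" unfolding P_def idx_def by blast
  qed
  have SC: "S \<subseteq> (\<Union>n. C n)"
  proof
    fix x assume "x \<in> S"
    then obtain y where y: "y \<in> K" "x \<in> A y" using S by blast
    then obtain Q where "Q \<in> \<D>" "y \<in> Q" using D(6) by blast
    then show "x \<in> (\<Union>n. C n)" using B(2)[of Q] y by (auto simp: C_def idx_def)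
  qed
  have "emeasure lebesgue S \<le> emeasure lebesgue (\<Union>n. C n)"
    by (rule emeasure_mono[OF SC]) (use Cmeas in blast)
  also have "\<dots> \<le> (\<Sum>n. emeasure lebesgue (C n))"
    by (rule emeasure_subadditive_countably) (use Cmeas in blast)
  also have "\<dots> \<le> (\<Sum>n. emeasure \<mu> (P n))"
    using CP by (intro suminf_le) auto
  also have "\<dots> = emeasure \<mu> (\<Union>n. P n)"
    by (rule suminf_emeasure[OF _ disj]) (use Pmeas in blast)
  also have "\<dots> \<le> emeasure \<mu> (space \<mu>)" by (rule emeasure_space)
  also have "\<dots> = (\<integral>\<^sup>+y. dens y \<partial>lebesgue)"
    unfolding \<mu>_def by (subst emeasure_density[OF measdens]) auto
  also have "\<dots> = (\<integral>\<^sup>+y. indicator K y * ennreal (\<Theta> y + 2 * \<epsilon>) \<partial>lebesgue)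
      + (\<integral>\<^sup>+y. indicator (W - K) y * ennreal (M + 1) \<partial>lebesgue)"
    unfolding dens_def using WKs by (intro nn_integral_add meas\<Theta>) simp
  also have "(\<integral>\<^sup>+y. indicator K y * ennreal (\<Theta> y + 2 * \<epsilon>) \<partial>lebesgue)
      = (\<integral>\<^sup>+y. indicator K y * ennreal (\<Theta> y + 0) + ennreal (2 * \<epsilon>) * indicator K y \<partial>lebesgue)"
    using nonneg \<epsilon> by (intro nn_integral_cong) (auto simp: indicator_def)
  also have "\<dots> = (\<integral>\<^sup>+y. indicator K y * ennreal (\<Theta> y + 0) \<partial>lebesgue)
      + (\<integral>\<^sup>+y. ennreal (2 * \<epsilon>) * indicator K y \<partial>lebesgue)"
    using Ks by (intro nn_integral_add meas\<Theta>) simp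
  also have "(\<integral>\<^sup>+y. indicator K y * ennreal (\<Theta> y + 0) \<partial>lebesgue) = (\<integral>\<^sup>+x\<in>K. ennreal (\<Theta> x) \<partial>lebesgue)"
    by (simp add: mult.commute)
  also have "(\<integral>\<^sup>+y. ennreal (2 * \<epsilon>) * indicator K y \<partial>lebesgue) = ennreal (2 * \<epsilon> * k)"
    using Ks k \<epsilon> by (simp add: nn_integral_cmult_indicator ennreal_mult)
  also have "(\<integral>\<^sup>+y. indicator (W - K) y * ennreal (M + 1) \<partial>lebesgue)
      = ennreal (M + 1) * emeasure lebesgue (W - K)"
    using WKs by (simp add: nn_integral_cmult_indicator mult.commute)
  also have "(\<integral>\<^sup>+x\<in>K. ennreal (\<Theta> x) \<partial>lebesgue) + ennreal (2 * \<epsilon> * k)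
        + ennreal (M + 1) * emeasure lebesgue (W - K)
      \<le> (\<integral>\<^sup>+x\<in>K. ennreal (\<Theta> x) \<partial>lebesgue) + ennreal (e / 2) + ennreal (M + 1) * ennreal (e / (2 * (M + 1)))"
    using \<epsilon>(3) less_imp_le[OF W(4)] by (intro add_mono mult_left_mono order.refl ennreal_leI) auto
  also have "ennreal (M + 1) * ennreal (e / (2 * (M + 1))) = ennreal (e / 2)"
    using M \<open>e > 0\<close> by (subst ennreal_mult[symmetric]) (auto simp: field_simps)
  also have "(\<integral>\<^sup>+x\<in>K. ennreal (\<Theta> x) \<partial>lebesgue) + ennreal (e / 2) + ennreal (e / 2)
      = (\<integral>\<^sup>+x\<in>K. ennreal (\<Theta> x) \<partial>lebesgue) + ennreal e"
    using \<open>e > 0\<close> by (simp add: add.assoc flip: ennreal_plus)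
  finally show "emeasure lebesgue S \<le> (\<integral>\<^sup>+x\<in>K. ennreal (\<Theta> x) \<partial>lebesgue) + ennreal e" .
qed

section \<open>Pucci operators and quadratic test functions\<close>

text \<open>
  In matrix notation this is \<open>\<alpha> I - (\<alpha> + \<beta>) e e\<^sup>T\<close>. For a unit vector \<open>e\<close> it has the eigenvalue \<open>- \<beta>\<close> along
  \<open>e\<close> and \<open>\<alpha>\<close> on the orthogonal complement.
\<close>

definition axial_matrix :: "real \<Rightarrow> real \<Rightarrow> real^'n \<Rightarrow> real^'n^'n" where
  "axial_matrix \<alpha> \<beta> e = (\<chi> i j. (if i = j then \<alpha> else 0) - (\<alpha> + \<beta>) * (e$i * e$j))"

lemma axial_matrix_vector:
  "axial_matrix \<alpha> \<beta> e *v v = \<alpha> *\<^sub>R v - ((\<alpha> + \<beta>) * (e \<bullet> v)) *\<^sub>R e"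
proof (intro vec_eq_iff[THEN iffD2] allI)
  fix i
  have "(\<Sum>j\<in>UNIV. ((if i = j then \<alpha> else 0) - (\<alpha> + \<beta>) * (e$i * e$j)) * v$j)
      = (\<Sum>j\<in>UNIV. (if j = i then \<alpha> * v$j else 0)) - (\<alpha> + \<beta>) * e$i * (\<Sum>j\<in>UNIV. e$j * v$j)"
    unfolding sum_distrib_left sum_subtractf[symmetric]
    by (intro sum.cong) (auto simp: algebra_simps)
  then show "(axial_matrix \<alpha> \<beta> e *v v) $ i = (\<alpha> *\<^sub>R v - ((\<alpha> + \<beta>) * (e \<bullet> v)) *\<^sub>R e) $ i"
    by (simp add: axial_matrix_def matrix_vector_mult_def inner_vec_def algebra_simps)
qed

lemma axial_matrix_Sym: "axial_matrix \<alpha> \<beta> e \<in> Sym"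
  by (simp add: axial_matrix_def Sym_def transpose_def vec_eq_iff mult.commute)

text \<open>
  The eigenvalue \<open>\<alpha>\<close> has multiplicity at most \<open>N\<close>, and \<open>- \<beta>\<close> has multiplicity at least 1. These
  crude bounds avoid a case distinction for \<open>N = 1\<close>, where \<open>\<alpha>\<close> is not an eigenvalue.
\<close>

lemma pucci_max_axial_le:
  fixes e :: "real^'n"
  assumes "norm e = 1" "\<alpha> > 0" "\<beta> > 0" "lam \<ge> 0" "Lam \<ge> 0"
  shows "pucci_max lam Lam (axial_matrix \<alpha> \<beta> e) \<le> Lam * (real CARD('n) * \<alpha>) - lam * \<beta>"
proof -
  let ?X = "axial_matrix \<alpha> \<beta> e"
  have ee: "e \<bullet> e = 1" using assms(1) by (simp add: norm_eq_sqrt_inner)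
  have evs: "\<mu> = \<alpha> \<or> \<mu> = - \<beta>" if "\<mu> \<in> eigenvalues ?X" for \<mu>
  proof -
    from that obtain v where v: "v \<noteq> 0" "?X *v v = \<mu> *\<^sub>R v"
      by (auto simp: eigenvalues_def)
    have eq: "(\<alpha> - \<mu>) *\<^sub>R v = ((\<alpha> + \<beta>) * (e \<bullet> v)) *\<^sub>R e"
      using v(2) by (simp add: axial_matrix_vector algebra_simps)
    then have "e \<bullet> ((\<alpha> - \<mu>) *\<^sub>R v) = e \<bullet> (((\<alpha> + \<beta>) * (e \<bullet> v)) *\<^sub>R e)" by simp
    then have "(\<alpha> - \<mu>) * (e \<bullet> v) = (\<alpha> + \<beta>) * (e \<bullet> v)" using ee by simp
    then have "e \<bullet> v = 0 \<or> \<mu> = - \<beta>" by auto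
    with eq v(1) show ?thesis by auto
  qed
  have Xe: "?X *v e = (- \<beta>) *\<^sub>R e"
    using ee by (simp add: axial_matrix_vector algebra_simps)
  have e0: "e \<noteq> 0" using assms(1) by auto
  have neg: "{\<mu> \<in> eigenvalues ?X. \<mu> < 0} = {- \<beta>}"
    using evs Xe e0 assms by (fastforce simp: eigenvalues_def)
  have "e \<in> eigenspace ?X (- \<beta>)" using Xe by (simp add: eigenspace_def)
  then have "dim {e} \<le> dim (eigenspace ?X (- \<beta>))" by (intro dim_subset) auto
  then have d1: "1 \<le> real (dim (eigenspace ?X (- \<beta>)))" using e0 by (simp add: dim_singleton)
  have "(\<Sum>\<mu> | \<mu> \<in> eigenvalues ?X \<and> \<mu> > 0. real (dim (eigenspace ?X \<mu>)) * \<mu>)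
      \<le> (\<Sum>\<mu>\<in>{\<alpha>}. real (dim (eigenspace ?X \<mu>)) * \<mu>)"
  proof (rule sum_mono2)
    show "{\<mu>. \<mu> \<in> eigenvalues ?X \<and> \<mu> > 0} \<subseteq> {\<alpha>}"
    proof
      fix \<mu> assume "\<mu> \<in> {\<mu>. \<mu> \<in> eigenvalues ?X \<and> \<mu> > 0}"
      then show "\<mu> \<in> {\<alpha>}" using evs[of \<mu>] assms(3) by auto
    qed
  qed (use assms in auto)
  also have "\<dots> \<le> real CARD('n) * \<alpha>"
    using assms(2) by (simp add: dim_subset_UNIV_cart)
  finally have "Lam * (\<Sum>\<mu> | \<mu> \<in> eigenvalues ?X \<and> \<mu> > 0. real (dim (eigenspace ?X \<mu>)) * \<mu>)
      \<le> Lam * (real CARD('n) * \<alpha>)"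
    using assms by (intro mult_left_mono)
  moreover have "(\<Sum>\<mu> | \<mu> \<in> eigenvalues ?X \<and> \<mu> < 0. real (dim (eigenspace ?X \<mu>)) * \<mu>) \<le> - \<beta>"
    using d1 assms(3) by (simp add: neg)
  then have "lam * (\<Sum>\<mu> | \<mu> \<in> eigenvalues ?X \<and> \<mu> < 0. real (dim (eigenspace ?X \<mu>)) * \<mu>)
      \<le> lam * (- \<beta>)"
    using assms by (intro mult_left_mono)
  ultimately show ?thesis by (simp add: pucci_max_def)
qed

lemma pucci_min_uminus: "pucci_min lam Lam (- X) = - pucci_max lam Lam X"
proof -
  have mv: "(- X) *v v = - (X *v v)" for v
    by (simp add: matrix_vector_mult_def vec_eq_iff sum_negf)
  have neg: "- (X *v v) = e *\<^sub>R v \<longleftrightarrow> X *v v = - (e *\<^sub>R v)" for v e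
    using minus_equation_iff[of "X *v v" "e *\<^sub>R v"] by auto
  have es: "eigenspace (- X) e = eigenspace X (- e)" for e
    by (simp add: eigenspace_def mv neg)
  have ev: "e \<in> eigenvalues (- X) \<longleftrightarrow> - e \<in> eigenvalues X" for e
    by (simp add: eigenvalues_def mv neg)
  have 1: "(\<Sum>e | e \<in> eigenvalues (-X) \<and> e > 0. real (dim (eigenspace (-X) e)) * e)
      = (\<Sum>e | e \<in> eigenvalues X \<and> e < 0. - (real (dim (eigenspace X e)) * e))"
    by (rule sum.reindex_bij_witness[of _ uminus uminus]) (auto simp: es ev)
  have 2: "(\<Sum>e | e \<in> eigenvalues (-X) \<and> e < 0. real (dim (eigenspace (-X) e)) * e)
      = (\<Sum>e | e \<in> eigenvalues X \<and> e > 0. - (real (dim (eigenspace X e)) * e))"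
    by (rule sum.reindex_bij_witness[of _ uminus uminus]) (auto simp: es ev)
  show ?thesis by (simp add: pucci_min_def pucci_max_def 1 2 sum_negf)
qed

definition quadratic_at :: "real^'n \<Rightarrow> real^'n \<Rightarrow> real^'n^'n \<Rightarrow> real^'n \<Rightarrow> real" where
  "quadratic_at z \<xi> X y = \<xi> \<bullet> (y - z) + (y - z) \<bullet> (X *v (y - z)) / 2"

text \<open>
  As test functions, these polynomials turn the viscosity condition into an inequality for a
  prescribed gradient \<open>\<xi>\<close> and Hessian \<open>X\<close>. Being of class \<open>C\<^sup>2\<close> everywhere, they are admissible in
  whatever set the condition is posed.
\<close>

lemma
  fixes X :: "real^'n^'n"
  assumes "X \<in> Sym"
  shows quadratic_at_C2: "C2_on U (quadratic_at z \<xi> X)"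
    and grad_quadratic_at: "grad (quadratic_at z \<xi> X) z = \<xi>"
    and hess_quadratic_at: "hess (quadratic_at z \<xi> X) x = X"
proof -
  let ?q = "quadratic_at z \<xi> X"
  have sym: "v \<bullet> (X *v w) = (X *v v) \<bullet> w" for v w
    using assms dot_lmul_matrix[of v X w] vector_transpose_matrix[of v X] by (simp add: Sym_def)
  have dX: "((\<lambda>y. X *v (y - z)) has_derivative (\<lambda>h. X *v h)) (at x)" for x
    by (rule derivative_eq_intros bounded_linear.has_derivative[OF matrix_vector_mul_bounded_linear] refl)+
       (simp)
  have dq: "(?q has_derivative (\<lambda>h. (\<xi> + X *v (x - z)) \<bullet> h)) (at x)" for x
  proof -
    have eq: "?q = (\<lambda>y. \<xi> \<bullet> (y - z) + (1/2) * ((y - z) \<bullet> (X *v (y - z))))"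
      by (simp add: fun_eq_iff quadratic_at_def)
    have dz: "((\<lambda>y. y - z) has_derivative (\<lambda>h. h)) (at x)"
      by (rule has_derivative_eq_rhs[OF has_derivative_diff[OF has_derivative_ident has_derivative_const]]) simp
    show ?thesis
      unfolding eq
      by (rule has_derivative_eq_rhs[OF has_derivative_add[OF has_derivative_inner_right[OF dz]
            has_derivative_mult_right[OF has_derivative_inner[OF dz dX]]]])
         (simp add: fun_eq_iff sym[of "x - z"] inner_add_left inner_commute[of _ "X *v (x - z)"])
  qed
  have g: "grad ?q = (\<lambda>x. \<xi> + X *v (x - z))"
    by (simp add: fun_eq_iff grad_def vec_eq_iff frechet_derivative_at[OF dq, symmetric] inner_axis)
  have dg: "(grad ?q has_derivative (\<lambda>h. X *v h)) (at x)" for x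
    unfolding g by (rule derivative_eq_intros dX refl)+ simp
  show hq: "hess ?q x = X" for x
    by (simp add: hess_def frechet_derivative_at[OF dg, symmetric])
  show "grad ?q z = \<xi>" by (simp add: g)
  show "C2_on U ?q"
    using dq dg by (auto simp: C2_on_def differentiable_def hq)
qed

section \<open>Slopes at nearby contact points\<close>

text \<open>
  Suppose the slopes differ by \<open>\<eta> = \<xi>1 - \<xi>0\<close> with \<open>\<bar>\<eta>\<bar> > t\<close>, and let \<open>e = - \<eta> / \<bar>\<eta>\<bar>\<close>. Write \<open>v\<close> for \<open>u\<close> minus the
  plane at \<open>x0\<close> and \<open>s\<close> for the coordinate along \<open>e\<close> centred at \<open>x0\<close>. The first plane
  gives \<open>v \<le> 0\<close>, the second gives \<open>v \<le> - t (s - r)\<close> where \<open>s \<ge> r\<close>, and \<open>v x0 = 0\<close>. With \<open>w\<close> the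
  component orthogonal to \<open>e\<close>, the barrier is
  \<open>\<phi> = (t / r) (A \<bar>w\<bar>\<^sup>2 - (s + r)\<^sup>2 / 8)\<close> on the cylinder \<open>- r \<le> s \<le> 3 r\<close>, \<open>\<bar>w\<bar> \<le> \<rho> r\<close>:
  it is nonnegative on the face \<open>s = - r\<close>, at least \<open>- 2 t r\<close> on the face \<open>s = 3 r\<close>, nonnegative on the lateral
  face because \<open>A \<rho>\<^sup>2 = 2\<close>, and negative at \<open>x0\<close>. So \<open>v - \<phi>\<close> has an interior maximum.
  The choice of \<open>A\<close> makes the upward bending across \<open>e\<close> cost at most half of the gain
  \<open>lam t / (4 r)\<close> from bending down along \<open>e\<close>.
\<close>

lemma barrier_slope_bound:
  fixes u f a :: "real^'n \<Rightarrow> real" and H :: "real^'n \<Rightarrow> real^'n \<Rightarrow> real" and \<xi>0 \<xi>1 :: "real^'n"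
  assumes lam: "0 < lam" "0 < Lam" and L1: "0 < L1" and pq: "0 < p" "0 < q"
    and jets: "\<And>z \<xi> X. z \<in> U \<Longrightarrow> X \<in> Sym \<Longrightarrow> local_max_at (\<lambda>y. u y - quadratic_at z \<xi> X y) z \<Longrightarrow>
                 f z \<le> H z \<xi> * pucci_max lam Lam X"
    and H: "\<And>z \<xi>. z \<in> U \<Longrightarrow> L1 * (norm \<xi> powr p + a z * norm \<xi> powr q) \<le> H z \<xi>"
    and a: "\<And>z. z \<in> U \<Longrightarrow> 0 \<le> a z"
    and u: "continuous_on U u"
    and A: "A = lam / (16 * Lam * real CARD('n))" and \<rho>: "0 < \<rho>" "A * \<rho>\<^sup>2 = 2"
    and r: "0 < r" "cball x0 ((\<rho> + 3) * r) \<subseteq> U"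
    and x1: "norm (x1 - x0) \<le> r"
    and contact0: "\<And>y. y \<in> U \<Longrightarrow> u y \<le> u x0 + \<xi>0 \<bullet> (y - x0)"
    and contact1: "\<And>y. y \<in> U \<Longrightarrow> u y \<le> u x1 + \<xi>1 \<bullet> (y - x1)"
    and \<kappa>: "0 < \<kappa>" "2 * \<kappa> \<le> norm \<xi>0"
    and t: "0 < t" "t * (2 * A * \<rho> + 1) \<le> \<kappa>"
    and f: "\<And>z. z \<in> cball x0 ((\<rho> + 3) * r) \<Longrightarrow>
              - (L1 * min (\<kappa> powr p) (\<kappa> powr q) * lam * t / (8 * r)) * (1 + a z) < f z"
  shows "norm (\<xi>1 - \<xi>0) \<le> t"
proof (rule ccontr)
  assume "\<not> norm (\<xi>1 - \<xi>0) \<le> t"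
  define \<eta> where "\<eta> = \<xi>1 - \<xi>0"
  have \<eta>: "norm \<eta> > t" using \<open>\<not> _\<close> by (simp add: \<eta>_def)
  have \<eta>0: "norm \<eta> \<noteq> 0" using \<eta> t by linarith
  define e where "e = - (\<eta> /\<^sub>R norm \<eta>)"
  have e: "norm e = 1" using \<eta>0 by (simp add: e_def)
  have \<eta>e: "\<eta> = - (norm \<eta> *\<^sub>R e)" using \<eta>0 by (simp add: e_def)
  have ee: "e \<bullet> e = 1" using e by (simp add: norm_eq_sqrt_inner)
  have A0: "A > 0" using lam by (simp add: A)
  define s where "s y = e \<bullet> (y - x0)" for y
  define w where "w y = (y - x0) - s y *\<^sub>R e" for y
  have w2: "(norm (w y))\<^sup>2 = (norm (y - x0))\<^sup>2 - (s y)\<^sup>2" for y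
  proof -
    have "(norm (d - (e \<bullet> d) *\<^sub>R e))\<^sup>2 = (norm d)\<^sup>2 - (e \<bullet> d)\<^sup>2" for d
      unfolding power2_norm_eq_inner
      by (simp add: inner_diff_left inner_diff_right ee inner_commute power2_eq_square)
    then show ?thesis by (simp add: w_def s_def)
  qed
  define \<phi> where "\<phi> y = (t / r) * (A * (norm (w y))\<^sup>2 - (s y + r)\<^sup>2 / 8)" for y
  define D where "D = {y. - r \<le> s y \<and> s y \<le> 3 * r \<and> norm (w y) \<le> \<rho> * r}"
  define Di where "Di = {y. - r < s y \<and> s y < 3 * r \<and> norm (w y) < \<rho> * r}"
  have cs: "continuous_on UNIV s" and cw: "continuous_on UNIV w"
    by (auto simp: s_def w_def intro!: continuous_intros)
  have Dsub: "D \<subseteq> cball x0 ((\<rho> + 3) * r)"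
  proof
    fix y assume y: "y \<in> D"
    have "norm (y - x0) = norm (w y + s y *\<^sub>R e)" by (simp add: w_def)
    also have "\<dots> \<le> norm (w y) + \<bar>s y\<bar>" using norm_triangle_ineq[of "w y" "s y *\<^sub>R e"] e by simp
    also have "\<dots> \<le> \<rho> * r + 3 * r" using y r by (auto simp: D_def)
    finally show "y \<in> cball x0 ((\<rho> + 3) * r)"
      by (simp add: dist_norm norm_minus_commute algebra_simps)
  qed
  have "D = {y. - r \<le> s y} \<inter> {y. s y \<le> 3 * r} \<inter> {y. norm (w y) \<le> \<rho> * r}"
    by (auto simp: D_def)
  also have "closed \<dots>"
    by (intro closed_Int closed_Collect_le continuous_intros cs cw)
  finally have "closed D" .
  then have Dc: "compact D"
    using Dsub bounded_subset[OF bounded_cball] by (auto simp: compact_eq_bounded_closed)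
  have "Di = {y. - r < s y} \<inter> {y. s y < 3 * r} \<inter> {y. norm (w y) < \<rho> * r}"
    by (auto simp: Di_def)
  also have "open \<dots>"
    by (intro open_Int open_Collect_less continuous_intros cs cw)
  finally have Dio: "open Di" .
  have x0D: "x0 \<in> D" using r \<rho> by (simp add: D_def s_def w_def)
  define v where "v y = u y - (u x0 + \<xi>0 \<bullet> (y - x0))" for y
  have v0: "v y \<le> 0" if "y \<in> U" for y using contact0[OF that] by (simp add: v_def)
  have x1U: "x1 \<in> U"
  proof -
    have "r \<le> (\<rho> + 3) * r" using r \<rho> by simp
    then have "x1 \<in> cball x0 ((\<rho> + 3) * r)"
      using x1 by (simp add: dist_norm norm_minus_commute)
    then show ?thesis using r by blast
  qed
  \<comment> \<open>The point \<open>x1\<close> is at most \<open>r\<close> ahead of \<open>x0\<close> in the direction \<open>e\<close>, so the face \<open>s = 3 r\<close> is at least \<open>2 r\<close> ahead of \<open>x1\<close>.\<close>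
  have v1: "v y \<le> - (2 * t * r)" if "y \<in> U" "s y = 3 * r" for y
  proof -
    have "v y \<le> \<eta> \<bullet> (y - x1)"
      using contact1[OF that(1)] contact0[OF x1U]
      by (simp add: v_def \<eta>_def inner_diff_left inner_diff_right algebra_simps)
    also have "\<dots> = - (norm \<eta> * (s y - e \<bullet> (x1 - x0)))"
      by (subst \<eta>e) (simp add: s_def inner_diff_right algebra_simps)
    also have "\<dots> \<le> - (t * (2 * r))"
    proof -
      have "e \<bullet> (x1 - x0) \<le> r"
        using norm_cauchy_schwarz[of e "x1 - x0"] e x1 by simp
      then have "2 * r \<le> s y - e \<bullet> (x1 - x0)" using that(2) by linarith
      then show ?thesis using \<eta> t r by (simp add: mult_mono)
    qed
    finally show ?thesis by simp
  qed
  have "continuous_on D (\<lambda>y. v y - \<phi> y)"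
    unfolding v_def \<phi>_def using Dsub r
    by (intro continuous_intros continuous_on_subset[OF u] continuous_on_subset[OF cs]
        continuous_on_subset[OF cw]) auto
  then obtain z where z: "z \<in> D" "\<And>y. y \<in> D \<Longrightarrow> v y - \<phi> y \<le> v z - \<phi> z"
    using continuous_attains_sup[OF Dc] x0D by blast
  have zU: "z \<in> U" using z(1) Dsub r by blast
  have "v x0 - \<phi> x0 = t * r / 8"
    using r by (simp add: v_def \<phi>_def s_def w_def power2_eq_square)
  then have pos: "v z - \<phi> z > 0" using z(2)[OF x0D] t r
    by (metis (no_types, opaque_lifting) divide_pos_pos mult_pos_pos order_less_le_trans zero_less_numeral)
  have zi: "z \<in> Di"
  proof (rule ccontr)
    assume "z \<notin> Di"
    then consider "s z = - r" | "s z = 3 * r" | "norm (w z) = \<rho> * r"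
      using z(1) by (auto simp: D_def Di_def)
    then show False
    proof cases
      case 1
      then have "\<phi> z \<ge> 0" using t r A0 by (simp add: \<phi>_def)
      then show False using pos v0[OF zU] by linarith
    next
      case 2
      have "(t / r) * (- 2 * r\<^sup>2) \<le> \<phi> z"
        unfolding \<phi>_def using 2 t r A0 by (intro mult_left_mono) (auto simp: power2_eq_square)
      moreover have "(t / r) * (- 2 * r\<^sup>2) = - (2 * t * r)"
        using r by (simp add: power2_eq_square)
      ultimately show False using pos v1[OF zU 2] by linarith
    next
      case 3
      have "(s z + r)\<^sup>2 \<le> (4 * r)\<^sup>2"
        using z(1) by (intro power_mono) (auto simp: D_def)
      moreover have "A * (norm (w z))\<^sup>2 = 2 * r\<^sup>2"
        unfolding 3 power_mult_distrib using \<rho> by (simp flip: mult.assoc)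
      ultimately have "0 \<le> A * (norm (w z))\<^sup>2 - (s z + r)\<^sup>2 / 8"
        by (simp add: power2_eq_square)
      then have "\<phi> z \<ge> 0" unfolding \<phi>_def using t r by (intro mult_nonneg_nonneg) auto
      then show False using pos v0[OF zU] by linarith
    qed
  qed
  define \<xi> where "\<xi> = \<xi>0 + (t / r) *\<^sub>R ((2 * A) *\<^sub>R w z - ((s z + r) / 4) *\<^sub>R e)"
  define X where "X = axial_matrix (2 * A * t / r) (t / (4 * r)) e"
  \<comment> \<open>Expanding the barrier at \<open>z\<close> shows that, up to a constant, plane plus barrier is the quadratic polynomial with data \<open>\<xi>\<close> and \<open>X\<close>.\<close>
  have expand: "v y - \<phi> y = u y - quadratic_at z \<xi> X y - u x0 - \<xi>0 \<bullet> (z - x0) - \<phi> z" for y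
  proof -
    define h where "h = y - z"
    have sy: "s y = s z + e \<bullet> h" by (simp add: s_def h_def inner_diff_right)
    have wy: "w y = w z + (h - (e \<bullet> h) *\<^sub>R e)" by (simp add: w_def sy h_def algebra_simps)
    have ew: "e \<bullet> w z = 0" by (simp add: w_def s_def inner_diff_right ee)
    have n: "(norm (w y))\<^sup>2 = (norm (w z))\<^sup>2 + 2 * (w z \<bullet> h) + h \<bullet> h - (e \<bullet> h)\<^sup>2"
      unfolding wy power2_norm_eq_inner using ew ee
      by (simp add: inner_diff_left inner_diff_right inner_add_left inner_add_right
          inner_commute power2_eq_square algebra_simps)
    have "\<phi> y = \<phi> z + (t / r) * (2 * A * (w z \<bullet> h) - (s z + r) / 4 * (e \<bullet> h))
        + (t / r) * (A * (h \<bullet> h) - (A + 1 / 8) * (e \<bullet> h)\<^sup>2)"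
      unfolding \<phi>_def n unfolding sy by (simp add: power2_eq_square algebra_simps add_divide_distrib)
    moreover have "quadratic_at z \<xi> X y = \<xi>0 \<bullet> h + (t / r) * (2 * A * (w z \<bullet> h) - (s z + r) / 4 * (e \<bullet> h))
        + (t / r) * (A * (h \<bullet> h) - (A + 1 / 8) * (e \<bullet> h)\<^sup>2)"
    proof -
      have "\<xi> \<bullet> h = \<xi>0 \<bullet> h + (t / r) * (2 * A * (w z \<bullet> h) - (s z + r) / 4 * (e \<bullet> h))"
        by (simp add: \<xi>_def inner_add_left inner_diff_left)
      moreover have "h \<bullet> (X *v h) = 2 * A * t / r * (h \<bullet> h) - (2 * A * t / r + t / (4 * r)) * (e \<bullet> h)\<^sup>2"
        by (simp add: X_def axial_matrix_vector inner_diff_right inner_commute[of h e] power2_eq_square)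
      moreover have half: "(2 * A * t / r * (h \<bullet> h) - (2 * A * t / r + t / (4 * r)) * (e \<bullet> h)\<^sup>2) / 2
          = (t / r) * (A * (h \<bullet> h) - (A + 1 / 8) * (e \<bullet> h)\<^sup>2)"
        using r by (simp add: field_simps)
      ultimately show ?thesis
        unfolding quadratic_at_def h_def[symmetric] by simp
    qed
    ultimately show ?thesis by (simp add: v_def h_def inner_diff_right)
  qed
  have "local_max_at (\<lambda>y. u y - quadratic_at z \<xi> X y) z"
    unfolding local_max_at_def
  proof (rule eventually_mono[OF eventually_nhds_in_open[OF Dio zi]])
    fix y assume "y \<in> Di"
    then have "y \<in> D" by (auto simp: D_def Di_def)
    from z(2)[OF this] show "u y - quadratic_at z \<xi> X y \<le> u z - quadratic_at z \<xi> X z"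
      unfolding expand by simp
  qed
  from jets[OF zU _ this] have fz: "f z \<le> H z \<xi> * pucci_max lam Lam X"
    by (simp add: X_def axial_matrix_Sym)
  have pucci: "pucci_max lam Lam X \<le> - (lam * t / (8 * r))"
  proof -
    have "pucci_max lam Lam X \<le> Lam * (real CARD('n) * (2 * A * t / r)) - lam * (t / (4 * r))"
      unfolding X_def using e A0 t r lam by (intro pucci_max_axial_le) auto
    also have "Lam * (real CARD('n) * (2 * A * t / r)) = lam * t / (8 * r)"
      unfolding A using lam r by (simp add: field_simps)
    finally show ?thesis using r by (simp add: field_simps)
  qed
  have n\<xi>: "\<kappa> \<le> norm \<xi>"
  proof -
    have "norm ((t / r) *\<^sub>R ((2 * A) *\<^sub>R w z - ((s z + r) / 4) *\<^sub>R e))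
        \<le> (t / r) * (2 * A * norm (w z) + (s z + r) / 4)"
    proof -
      have "norm ((2 * A) *\<^sub>R w z - ((s z + r) / 4) *\<^sub>R e) \<le> 2 * A * norm (w z) + (s z + r) / 4"
        using A0 e z(1) norm_triangle_ineq4[of "(2 * A) *\<^sub>R w z" "((s z + r) / 4) *\<^sub>R e"]
        by (simp add: D_def)
      then have "(t / r) * norm ((2 * A) *\<^sub>R w z - ((s z + r) / 4) *\<^sub>R e)
          \<le> (t / r) * (2 * A * norm (w z) + (s z + r) / 4)"
        using t r by (intro mult_left_mono) auto
      then show ?thesis using t r by simp
    qed
    also have "\<dots> \<le> (t / r) * (2 * A * (\<rho> * r) + r)"
      using z(1) t r A0 by (intro mult_left_mono add_mono) (auto simp: D_def)
    also have "\<dots> = t * (2 * A * \<rho> + 1)" using r by (simp add: field_simps)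
    also have "\<dots> \<le> \<kappa>" by fact
    finally have "norm ((t / r) *\<^sub>R ((2 * A) *\<^sub>R w z - ((s z + r) / 4) *\<^sub>R e)) \<le> \<kappa>" .
    moreover have "norm \<xi>0 - norm ((t / r) *\<^sub>R ((2 * A) *\<^sub>R w z - ((s z + r) / 4) *\<^sub>R e)) \<le> norm \<xi>"
      unfolding \<xi>_def by (rule norm_diff_ineq)
    ultimately show ?thesis using \<kappa> by linarith
  qed
  define m where "m = min (\<kappa> powr p) (\<kappa> powr q)"
  have "m * (1 + a z) \<le> norm \<xi> powr p + a z * norm \<xi> powr q"
  proof -
    have "m \<le> norm \<xi> powr p" "m \<le> norm \<xi> powr q"
      using powr_mono2[of p \<kappa> "norm \<xi>"] powr_mono2[of q \<kappa> "norm \<xi>"] n\<xi> \<kappa> pq by (auto simp: m_def)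
    then show ?thesis using a[OF zU] mult_left_mono[of m "norm \<xi> powr q" "a z"]
      by (simp add: distrib_left mult.commute)
  qed
  then have Hm: "L1 * (m * (1 + a z)) \<le> H z \<xi>"
    using H[OF zU, of \<xi>] L1 by (meson mult_left_mono order_trans less_imp_le)
  have "m > 0" using \<kappa> by (simp add: m_def)
  then have "0 \<le> L1 * (m * (1 + a z))" using L1 a[OF zU] by simp
  then have "H z \<xi> * pucci_max lam Lam X \<le> H z \<xi> * - (lam * t / (8 * r))"
    using pucci Hm by (intro mult_left_mono) auto
  also have "\<dots> \<le> L1 * (m * (1 + a z)) * - (lam * t / (8 * r))"
    using Hm lam t r by (intro mult_right_mono_neg) auto
  also have "\<dots> = - (L1 * m * lam * t / (8 * r)) * (1 + a z)" by (simp add: field_simps)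
  finally show False using fz f[of z] z(1) Dsub unfolding m_def by (auto simp: subset_iff)
qed

section \<open>The volume of the slopes at contact points\<close>

text \<open>
  All slopes in a ball of radius \<open>\<kappa>\<close> with centre at distance \<open>3 \<kappa>\<close> from the origin are realised at
  contact points, because \<open>m + 4 \<kappa> diam \<Omega> < u x0\<close> keeps the touching points off the boundary. Those slopes have norm
  at least \<open>2 \<kappa>\<close>, as the barrier estimate requires. Choosing a ball rather than an annulus lets the
  volume of the unit ball cancel. The contact set \<open>K\<close> used here is cut out by slopes of norm at most
  \<open>4 \<kappa>\<close>, which makes it a compact subset of \<open>{u > 0}\<close>, so that \<open>f\<close> is bounded on it even
  if \<open>f\<close> blows up at the boundary.
\<close>

lemma contact_slopes_volume_bound:
  fixes u f a :: "real^'n \<Rightarrow> real" and H :: "real^'n \<Rightarrow> real^'n \<Rightarrow> real"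
  assumes lam: "0 < lam" "0 < Lam" and L1: "0 < L1" and pq: "0 < p" "0 < q"
    and \<Omega>: "open \<Omega>" "bounded \<Omega>"
    and jets: "\<And>z \<xi> X. z \<in> \<Omega> \<Longrightarrow> 0 < u z \<Longrightarrow> X \<in> Sym \<Longrightarrow>
                 local_max_at (\<lambda>y. u y - quadratic_at z \<xi> X y) z \<Longrightarrow>
                 f z \<le> H z \<xi> * pucci_max lam Lam X"
    and H: "\<And>z \<xi>. z \<in> \<Omega> \<Longrightarrow> L1 * (norm \<xi> powr p + a z * norm \<xi> powr q) \<le> H z \<xi>"
    and a: "\<And>z. z \<in> \<Omega> \<Longrightarrow> 0 \<le> a z"
    and cont: "continuous_on (closure \<Omega>) u" "continuous_on \<Omega> f" "continuous_on \<Omega> a"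
    and m: "0 \<le> m" "\<And>b. b \<in> frontier \<Omega> \<Longrightarrow> u b \<le> m"
    and x0: "x0 \<in> \<Omega>" and \<kappa>: "0 < \<kappa>" "m + 4 * \<kappa> * diameter \<Omega> < u x0"
    and i: "0 \<le> i" "(\<integral>\<^sup>+x\<in>upper_contact_set \<Omega> (pos_part u).
              ennreal (\<bar>neg_part f x / (1 + a x)\<bar> ^ CARD('n)) \<partial>lebesgue) = ennreal i"
  shows "\<kappa> ^ CARD('n) \<le>
    (8 / (lam * L1 * min (\<kappa> powr p) (\<kappa> powr q)) * sqrt (real CARD('n))) ^ CARD('n) * i"
proof -
  let ?N = "CARD('n)" and ?E = "closure \<Omega>" and ?d = "diameter \<Omega>"
  define contact where "contact \<xi> x \<longleftrightarrow> (\<forall>y\<in>?E. u y \<le> u x + \<xi> \<bullet> (y - x))" for \<xi> x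
  define K where "K = {x\<in>?E. \<exists>\<xi>\<in>cball 0 (4 * \<kappa>). contact \<xi> x}"
  define U where "U = {x\<in>\<Omega>. 0 < u x}"
  have Ec: "compact ?E" using \<Omega> by (simp add: compact_closure)
  have sub: "\<Omega> \<subseteq> ?E" by (rule closure_subset)
  have Ene: "?E \<noteq> {}" using x0 sub by blast
  \<comment> \<open>A plane of slope at most \<open>4 \<kappa>\<close> that touches \<open>u\<close> from above exceeds \<open>m\<close> on all of the closure. As \<open>m \<ge> 0\<close>, it then also touches the positive part of \<open>u\<close>.\<close>
  have Kpos: "m < u x0 + \<xi> \<bullet> (y - x0)" "u x0 + \<xi> \<bullet> (y - x0) \<le> u x + \<xi> \<bullet> (y - x)"
    if "contact \<xi> x" "norm \<xi> \<le> 4 * \<kappa>" "y \<in> ?E" for \<xi> x y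
  proof -
    have "norm (y - x0) \<le> ?d"
      using diameter_bounded_bound[of ?E y x0] that \<Omega> x0 sub diameter_closure[of \<Omega>]
      by (auto simp: dist_norm)
    then have "norm \<xi> * norm (y - x0) \<le> 4 * \<kappa> * ?d"
      using that(2) \<kappa> by (intro mult_mono) auto
    then have "\<bar>\<xi> \<bullet> (y - x0)\<bar> \<le> 4 * \<kappa> * ?d" using Cauchy_Schwarz_ineq2[of \<xi> "y - x0"] by linarith
    then show "m < u x0 + \<xi> \<bullet> (y - x0)" using \<kappa>(2) by linarith
    have "u x0 \<le> u x + \<xi> \<bullet> (x0 - x)" using that(1) x0 sub by (auto simp: contact_def)
    then show "u x0 + \<xi> \<bullet> (y - x0) \<le> u x + \<xi> \<bullet> (y - x)" by (simp add: inner_diff_right)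
  qed
  have KU: "x \<in> \<Omega> \<and> 0 < u x" if "x \<in> ?E" "contact \<xi> x" "norm \<xi> \<le> 4 * \<kappa>" for \<xi> x
  proof -
    have "m < u x" using Kpos[OF that(2,3,1)] by simp
    moreover then have "x \<notin> frontier \<Omega>" using m(2)[of x] by auto
    ultimately show ?thesis
      using that(1) m(1) \<Omega>(1) by (auto simp: frontier_def interior_open)
  qed
  have K\<Omega>: "K \<subseteq> U" using KU by (auto simp: K_def U_def)
  have Kcontact: "K \<subseteq> upper_contact_set \<Omega> (pos_part u)"
  proof
    fix x assume "x \<in> K"
    then obtain \<xi> where \<xi>: "x \<in> ?E" "norm \<xi> \<le> 4 * \<kappa>" "contact \<xi> x" by (auto simp: K_def)
    have "pos_part u y \<le> pos_part u x + \<xi> \<bullet> (y - x)" if "y \<in> \<Omega>" for y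
    proof -
      have "u y \<le> u x + \<xi> \<bullet> (y - x)" using \<xi>(3) that sub by (auto simp: contact_def)
      moreover have "0 \<le> u x + \<xi> \<bullet> (y - x)" using Kpos[OF \<xi>(3,2), of y] that sub m(1) by auto
      moreover have "pos_part u x = u x" using KU[OF \<xi>(1,3,2)] by (simp add: pos_part_def)
      ultimately show ?thesis by (simp add: pos_part_def)
    qed
    then show "x \<in> upper_contact_set \<Omega> (pos_part u)"
      using KU[OF \<xi>(1,3,2)] by (auto simp: upper_contact_set_def)
  qed
  have Kc: "compact K"
  proof -
    define Z where "Z y = {p \<in> ?E \<times> cball 0 (4 * \<kappa>). u y \<le> u (fst p) + snd p \<bullet> (y - fst p)}" for y
    have Zc: "closed (Z y)" for y
    proof -
      have "continuous_on (?E \<times> cball 0 (4 * \<kappa>)) (\<lambda>p. u (fst p) + snd p \<bullet> (y - fst p))"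
        by (intro continuous_intros continuous_on_compose2[OF cont(1)]) auto
      then have "closed ((?E \<times> cball 0 (4 * \<kappa>)) \<inter> (\<lambda>p. u (fst p) + snd p \<bullet> (y - fst p)) -` {u y..})"
        by (intro continuous_closed_preimage closed_Times) auto
      also have "(?E \<times> cball 0 (4 * \<kappa>)) \<inter> (\<lambda>p. u (fst p) + snd p \<bullet> (y - fst p)) -` {u y..} = Z y"
        by (auto simp: Z_def)
      finally show ?thesis .
    qed
    have "compact ((?E \<times> cball 0 (4 * \<kappa>)) \<inter> (\<Inter>y\<in>?E. Z y))"
      by (intro compact_Int_closed compact_Times Ec compact_cball closed_INT ballI Zc)
    then have "compact (fst ` ((?E \<times> cball 0 (4 * \<kappa>)) \<inter> (\<Inter>y\<in>?E. Z y)))"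
      by (intro compact_continuous_image continuous_intros)
    also have "fst ` ((?E \<times> cball 0 (4 * \<kappa>)) \<inter> (\<Inter>y\<in>?E. Z y)) = K"
    proof -
      have mem: "x \<in> K \<longleftrightarrow> (\<exists>\<xi>. (x, \<xi>) \<in> (?E \<times> cball 0 (4 * \<kappa>)) \<inter> (\<Inter>y\<in>?E. Z y))" for x
        unfolding K_def Z_def contact_def by auto
      have img: "fst ` M = {x. \<exists>\<xi>. (x, \<xi>) \<in> M}" for M :: "((real^'n) \<times> (real^'n)) set"
        by force
      show ?thesis by (simp only: img mem[symmetric] Collect_mem_eq)
    qed
    finally show ?thesis .
  qed
  obtain k :: 'n where True by blast
  define S where "S = cball ((3 * \<kappa>) *\<^sub>R axis k 1 :: real^'n) \<kappa>"
  have S: "2 * \<kappa> \<le> norm \<xi>" "norm \<xi> \<le> 4 * \<kappa>" if "\<xi> \<in> S" for \<xi>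
  proof -
    have c: "norm ((3 * \<kappa>) *\<^sub>R axis k 1 :: real^'n) = 3 * \<kappa>" using \<kappa> by simp
    have "norm ((3 * \<kappa>) *\<^sub>R axis k 1 - \<xi>) \<le> \<kappa>" using that by (simp add: S_def dist_norm)
    then show "2 * \<kappa> \<le> norm \<xi>" "norm \<xi> \<le> 4 * \<kappa>"
      using norm_triangle_ineq2[of "(3 * \<kappa>) *\<^sub>R axis k 1" \<xi>]
        norm_triangle_ineq2[of \<xi> "(3 * \<kappa>) *\<^sub>R axis k 1"] c
      by (auto simp: norm_minus_commute)
  qed
  define slopes where "slopes x = {\<xi>\<in>S. contact \<xi> x}" for x
  have cover: "S \<subseteq> (\<Union>x\<in>K. slopes x)"
  proof
    fix \<xi> assume \<xi>: "\<xi> \<in> S"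
    have "continuous_on ?E (\<lambda>y. u y - \<xi> \<bullet> y)" by (intro continuous_intros cont)
    then obtain x where x: "x \<in> ?E" "\<And>y. y \<in> ?E \<Longrightarrow> u y - \<xi> \<bullet> y \<le> u x - \<xi> \<bullet> x"
      using continuous_attains_sup[OF Ec Ene] by (metis (no_types, lifting))
    have "contact \<xi> x" unfolding contact_def
    proof
      fix y assume "y \<in> ?E"
      from x(2)[OF this] show "u y \<le> u x + \<xi> \<bullet> (y - x)" by (simp add: inner_diff_right)
    qed
    moreover then have "x \<in> K" using x(1) S(2)[OF \<xi>] by (auto simp: K_def)
    ultimately show "\<xi> \<in> (\<Union>x\<in>K. slopes x)" using \<xi> by (auto simp: slopes_def)
  qed
  define G where "G x = neg_part f x / (1 + a x)" for x
  have G0: "0 \<le> G x" if "x \<in> \<Omega>" for x using a[OF that] by (simp add: G_def neg_part_def)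
  have contG: "continuous_on \<Omega> G"
    unfolding G_def neg_part_def using a by (intro continuous_intros cont) (auto simp: add_nonneg_eq_0_iff)
  have Uo: "open U"
  proof -
    have "open (\<Omega> \<inter> u -` {0<..})"
      by (rule continuous_open_preimage[OF continuous_on_subset[OF cont(1) sub] \<Omega>(1) open_greaterThan])
    also have "\<Omega> \<inter> u -` {0<..} = U" by (auto simp: U_def)
    finally show ?thesis .
  qed
  define \<omega> where "\<omega> = unit_ball_vol (real ?N)"
  have \<omega>: "\<omega> > 0" by (simp add: \<omega>_def)
  have vol: "emeasure lebesgue (cball c r) = ennreal (\<omega> * r ^ ?N)" if "0 \<le> r" for r and c :: "real^'n"
    using emeasure_cball[OF that, of c] by (simp add: \<omega>_def)
  define mk where "mk = min (\<kappa> powr p) (\<kappa> powr q)"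
  have mk: "mk > 0" using \<kappa> by (simp add: mk_def)
  \<comment> \<open>With this constant and \<open>t = C1 r s\<close>, the hypothesis on \<open>f\<close> in the barrier estimate says precisely that \<open>G < s\<close>.\<close>
  define C1 where "C1 = 8 / (lam * L1 * mk)"
  have C1: "C1 > 0" using lam L1 mk by (simp add: C1_def)
  define c where "c = C1 * sqrt (real ?N)"
  have c: "c > 0" using C1 by (simp add: c_def)
  define A where "A = lam / (16 * Lam * real ?N)"
  have A: "A > 0" using lam by (simp add: A_def)
  define \<rho> where "\<rho> = sqrt (2 / A)"
  have \<rho>: "\<rho> > 0" "A * \<rho>\<^sup>2 = 2" using A by (auto simp: \<rho>_def)
  define \<Theta> where "\<Theta> x = \<omega> * c ^ ?N * G x ^ ?N" for x
  have contK: "continuous_on K G" using K\<Omega> by (intro continuous_on_subset[OF contG]) (auto simp: U_def)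
  have normOne: "norm (One :: real^'n) = sqrt (real ?N)"
    by (simp add: norm_eq_sqrt_inner inner_sum_left inner_sum_right inner_Basis if_distrib cong: if_cong)
  have local: "\<exists>\<delta>>0. \<forall>b h. h > 0 \<longrightarrow> x \<in> cbox b (b + h *\<^sub>R One) \<longrightarrow>
          cbox b (b + h *\<^sub>R One) \<subseteq> ball x \<delta> \<longrightarrow>
          (\<exists>B\<in>sets lebesgue. (\<Union>y\<in>K \<inter> cbox b (b + h *\<^sub>R One). slopes y) \<subseteq> B \<and>
             emeasure lebesgue B \<le> ennreal ((\<Theta> x + \<epsilon>) * h ^ DIM(real^'n)))"
    if x: "x \<in> K" and \<epsilon>: "\<epsilon> > 0" for x \<epsilon>
  proof -
    have xU: "x \<in> U" and x\<Omega>: "x \<in> \<Omega>" using x K\<Omega> by (auto simp: U_def)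
    \<comment> \<open>The slack \<open>\<epsilon>\<close> leaves room for a level \<open>s\<close> strictly above \<open>G x\<close>, which then bounds \<open>G\<close> near \<open>x\<close>.\<close>
    have "((\<lambda>s. \<omega> * c ^ ?N * s ^ ?N) \<longlongrightarrow> \<Theta> x) (at_right (G x))"
      unfolding \<Theta>_def by (intro tendsto_intros)
    then have "\<forall>\<^sub>F s in at_right (G x). \<omega> * c ^ ?N * s ^ ?N < \<Theta> x + \<epsilon>"
      using \<epsilon> by (intro order_tendstoD(2)) auto
    then have "\<forall>\<^sub>F s in at_right (G x). \<omega> * c ^ ?N * s ^ ?N < \<Theta> x + \<epsilon> \<and> G x < s"
      by (intro eventually_conj eventually_at_right_less)
    then obtain s where s: "\<omega> * c ^ ?N * s ^ ?N < \<Theta> x + \<epsilon>" "G x < s"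
      using eventually_happens'[OF trivial_limit_at_right_real] by blast
    have s0: "s > 0" using s(2) G0[OF x\<Omega>] by linarith
    have "open {z\<in>U. G z < s}"
    proof -
      have "continuous_on U G" by (rule continuous_on_subset[OF contG]) (auto simp: U_def)
      then have "open (U \<inter> G -` {..<s})" by (rule continuous_open_preimage[OF _ Uo open_lessThan])
      also have "U \<inter> G -` {..<s} = {z\<in>U. G z < s}" by auto
      finally show ?thesis .
    qed
    moreover have "x \<in> {z\<in>U. G z < s}" using xU s(2) by simp
    ultimately obtain d1 where d1: "d1 > 0" "ball x d1 \<subseteq> {z\<in>U. G z < s}"
      by (rule openE)
    \<comment> \<open>The diameter \<open>r\<close> of a cube inside \<open>ball x \<delta>\<close> is below \<open>2 \<delta>\<close>: the first entry of the minimum keeps the cylinders of the barrier inside the ball of radius \<open>d1\<close>, the second bounds the gradient of the barrier by \<open>\<kappa>\<close>.\<close>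
    define den where "den = 2 * C1 * s * (2 * A * \<rho> + 1)"
    have "2 * A * \<rho> + 1 > 0" using mult_pos_pos[OF A \<rho>(1)] by linarith
    then have den: "den > 0" using C1 s0 by (simp add: den_def)
    define \<delta> where "\<delta> = min (d1 / (2 * \<rho> + 7)) (\<kappa> / den)"
    have \<delta>: "\<delta> > 0" using d1(1) \<rho>(1) \<kappa>(1) den by (simp add: \<delta>_def)
    show ?thesis
    proof (intro exI[of _ \<delta>] conjI allI impI \<delta>)
      fix b :: "real^'n" and h :: real
      assume h: "h > 0" and xQ: "x \<in> cbox b (b + h *\<^sub>R One)" and Q: "cbox b (b + h *\<^sub>R One) \<subseteq> ball x \<delta>"
      let ?Q = "cbox b (b + h *\<^sub>R One)"
      define r where "r = h * sqrt (real ?N)"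
      have r0: "r > 0" using h by (simp add: r_def)
      have le: "\<forall>i\<in>Basis. b \<bullet> i \<le> (b + h *\<^sub>R One) \<bullet> i" using h by (simp add: inner_add_left)
      have rdist: "dist b (b + h *\<^sub>R One) = r"
        using h normOne by (simp add: dist_norm r_def)
      have rQ: "norm (y - z) \<le> r" if "y \<in> ?Q" "z \<in> ?Q" for y z
        using diameter_bounded_bound[of ?Q y z] that diameter_cbox[OF le] rdist by (simp add: dist_norm)
      have "b \<in> ball x \<delta>" "b + h *\<^sub>R One \<in> ball x \<delta>" using Q le by (auto simp: mem_box subset_iff simp del: mem_ball)
      then have r\<delta>: "r < 2 * \<delta>"
        using dist_triangle2[of b "b + h *\<^sub>R One" x] rdist by (auto simp: dist_commute)
      define t where "t = C1 * r * s"
      have t: "t > 0" using C1 r0 s0 by (simp add: t_def)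
      have t\<kappa>: "t * (2 * A * \<rho> + 1) \<le> \<kappa>"
      proof -
        have "t * (2 * A * \<rho> + 1) = r / 2 * den" by (simp add: t_def den_def)
        also have "\<dots> \<le> \<delta> * den" using r\<delta> den by (intro mult_right_mono) auto
        also have "\<dots> \<le> \<kappa> / den * den" using den by (intro mult_right_mono) (auto simp: \<delta>_def)
        finally show ?thesis using den by simp
      qed
      have big: "cball y ((\<rho> + 3) * r) \<subseteq> ball x d1" if "y \<in> ?Q" for y
      proof
        fix z assume "z \<in> cball y ((\<rho> + 3) * r)"
        moreover have "dist x y < \<delta>" using that Q by auto
        moreover have "(\<rho> + 3) * r \<le> (\<rho> + 3) * (2 * \<delta>)" using r\<delta> \<rho> by (intro mult_left_mono) auto
        moreover have "dist x z \<le> dist x y + dist y z" by (rule dist_triangle)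
        ultimately have "dist x z < \<delta> * (2 * \<rho> + 7)" by (auto simp: algebra_simps)
        also have "\<dots> \<le> d1 / (2 * \<rho> + 7) * (2 * \<rho> + 7)"
          using \<rho> by (intro mult_right_mono) (auto simp: \<delta>_def)
        finally show "z \<in> ball x d1" using \<rho> by simp
      qed
      have close: "norm (\<xi>1 - \<xi>0) \<le> t"
        if y: "y0 \<in> ?Q" "y1 \<in> ?Q" and \<xi>: "\<xi>0 \<in> slopes y0" "\<xi>1 \<in> slopes y1" for y0 y1 \<xi>0 \<xi>1
      proof (rule barrier_slope_bound[where U = U and f = f and H = H and a = a and u = u
            and r = r and \<rho> = \<rho> and A = A and \<kappa> = \<kappa> and p = p and q = q and ?L1.0 = L1
            and lam = lam and Lam = Lam and ?x0.0 = y0 and ?x1.0 = y1])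
        show "cball y0 ((\<rho> + 3) * r) \<subseteq> U" using big[OF y(1)] d1(2) by blast
        show "norm (y1 - y0) \<le> r" using rQ y by blast
        show "u y \<le> u y0 + \<xi>0 \<bullet> (y - y0)" "u y \<le> u y1 + \<xi>1 \<bullet> (y - y1)" if "y \<in> U" for y
          using \<xi> that sub by (auto simp: slopes_def contact_def U_def)
        show "2 * \<kappa> \<le> norm \<xi>0" using \<xi>(1) S by (simp add: slopes_def)
        show "continuous_on U u" using sub by (intro continuous_on_subset[OF cont(1)]) (auto simp: U_def)
        fix z assume "z \<in> cball y0 ((\<rho> + 3) * r)"
        then have z: "z \<in> U" "G z < s" using big[OF y(1)] d1(2) by blast+
        have "1 + a z > 0" using a[of z] z by (auto simp: U_def)
        then have "neg_part f z < s * (1 + a z)" using z(2) by (simp add: G_def pos_divide_less_eq)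
        then have "- s * (1 + a z) < f z" by (simp add: neg_part_def)
        moreover have "L1 * min (\<kappa> powr p) (\<kappa> powr q) * lam * t / (8 * r) = s"
          unfolding mk_def[symmetric] t_def C1_def using r0 lam L1 mk by (simp add: field_simps)
        ultimately show "- (L1 * min (\<kappa> powr p) (\<kappa> powr q) * lam * t / (8 * r)) * (1 + a z) < f z"
          by simp
      qed (use lam L1 pq jets H a A_def \<rho> r0 \<kappa> t t\<kappa> in \<open>auto simp: U_def\<close>)
      show "\<exists>B\<in>sets lebesgue. (\<Union>y\<in>K \<inter> ?Q. slopes y) \<subseteq> B \<and>
             emeasure lebesgue B \<le> ennreal ((\<Theta> x + \<epsilon>) * h ^ DIM(real^'n))"
      proof (cases "(\<Union>y\<in>K \<inter> ?Q. slopes y) = {}")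
        case True
        then show ?thesis by (intro bexI[of _ "{}"]) auto
      next
        case False
        then obtain y0 \<xi>0 where y0: "y0 \<in> ?Q" "\<xi>0 \<in> slopes y0" by blast
        have "(\<Union>y\<in>K \<inter> ?Q. slopes y) \<subseteq> cball \<xi>0 t"
          using close[OF y0(1) _ y0(2)] by (auto simp: dist_norm norm_minus_commute)
        moreover have "emeasure lebesgue (cball \<xi>0 t) \<le> ennreal ((\<Theta> x + \<epsilon>) * h ^ DIM(real^'n))"
        proof -
          have "\<omega> * t ^ ?N = (\<omega> * c ^ ?N * s ^ ?N) * h ^ ?N"
            by (simp add: t_def c_def r_def power_mult_distrib)
          also have "\<dots> \<le> (\<Theta> x + \<epsilon>) * h ^ ?N" using s(1) h by (intro mult_right_mono) auto
          finally show ?thesis using vol[of t \<xi>0] t by (simp add: ennreal_leI)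
        qed
        ultimately show ?thesis by (intro bexI[of _ "cball \<xi>0 t"]) auto
      qed
    qed
  qed
  have "ennreal (\<omega> * \<kappa> ^ ?N) = emeasure lebesgue S" using vol \<kappa> by (simp add: S_def)
  also have "\<dots> \<le> (\<integral>\<^sup>+x\<in>K. ennreal (\<Theta> x) \<partial>lebesgue)"
  proof (rule emeasure_le_integral_of_cubewise_bound[OF Kc _ _ cover local])
    show "continuous_on K \<Theta>" unfolding \<Theta>_def by (intro continuous_intros contK)
    show "0 \<le> \<Theta> x" if "x \<in> K" for x
      using that K\<Omega> G0[of x] \<omega> c by (auto simp: \<Theta>_def U_def)
  qed
  also have "\<dots> = (\<integral>\<^sup>+x. ennreal (\<omega> * c ^ ?N) * (indicator K x * ennreal (G x ^ ?N)) \<partial>lebesgue)"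
    using K\<Omega> G0 \<omega> c
    by (intro nn_integral_cong) (auto simp: \<Theta>_def U_def indicator_def ennreal_mult)
  also have "\<dots> = ennreal (\<omega> * c ^ ?N) * (\<integral>\<^sup>+x. indicator K x * ennreal (G x ^ ?N) \<partial>lebesgue)"
    by (intro nn_integral_cmult borel_measurable_indicator_times_ennreal Kc continuous_intros contK)
  also have "\<dots> \<le> ennreal (\<omega> * c ^ ?N) * ennreal i"
    unfolding i(2)[symmetric]
  proof (intro mult_left_mono nn_integral_mono)
    fix x
    show "indicator K x * ennreal (G x ^ ?N)
        \<le> ennreal (\<bar>neg_part f x / (1 + a x)\<bar> ^ ?N) * indicator (upper_contact_set \<Omega> (pos_part u)) x"
      using Kcontact K\<Omega> G0[of x] by (auto simp: indicator_def U_def G_def subset_iff simp del: abs_divide)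
  qed simp
  also have "\<dots> = ennreal (\<omega> * c ^ ?N * i)" using \<omega> c i by (simp add: ennreal_mult)
  finally have "\<omega> * \<kappa> ^ ?N \<le> \<omega> * (c ^ ?N * i)" using \<omega> c i by (simp add: mult.assoc)
  then have "\<kappa> ^ ?N \<le> c ^ ?N * i" using \<omega> by simp
  then show ?thesis by (simp add: c_def C1_def mk_def)
qed

section \<open>Powers and norms with extended values\<close>

lemma epowr_ennreal: "0 \<le> x \<Longrightarrow> epowr (ennreal x) r = ennreal (x powr r)"
  by (simp add: epowr_def)

lemma epowr_mono: "x \<le> y \<Longrightarrow> 0 \<le> r \<Longrightarrow> epowr x r \<le> epowr y r"
  by (cases x rule: ennreal_cases; cases y rule: ennreal_cases)
     (auto simp: epowr_def top_unique intro!: ennreal_leI powr_mono2)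

lemma rhs_term_mono:
  fixes A B :: "(real^'n) set"
  assumes "A \<subseteq> B" "\<And>x. x \<in> A \<Longrightarrow> \<bar>g x\<bar> \<le> \<bar>h x\<bar>" "0 < p" "0 < q"
  shows "rhs_term p q A g \<le> rhs_term p q B h"
proof -
  have "(\<integral>\<^sup>+x\<in>A. ennreal (\<bar>g x\<bar> ^ CARD('n)) \<partial>lebesgue) \<le> (\<integral>\<^sup>+x\<in>B. ennreal (\<bar>h x\<bar> ^ CARD('n)) \<partial>lebesgue)"
    using assms by (intro nn_integral_mono) (auto simp: indicator_def intro!: ennreal_leI power_mono)
  then have le: "LN_norm A g \<le> LN_norm B h" unfolding LN_norm_def by (rule epowr_mono) simp
  show ?thesis
    unfolding rhs_term_def less_eq_ennreal.rep_eq[symmetric]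
    using assms(3,4) by (intro max.mono epowr_mono le) simp_all
qed

lemma rhs_term_cases:
  fixes A :: "(real^'n) set"
  obtains "rhs_term p q A g = \<infinity>"
  | i where "0 \<le> i" "(\<integral>\<^sup>+x\<in>A. ennreal (\<bar>g x\<bar> ^ CARD('n)) \<partial>lebesgue) = ennreal i"
      "rhs_term p q A g = ereal (max ((i powr (1 / CARD('n))) powr (1 / (p + 1)))
         ((i powr (1 / CARD('n))) powr (1 / (q + 1))))"
proof (cases "\<integral>\<^sup>+x\<in>A. ennreal (\<bar>g x\<bar> ^ CARD('n)) \<partial>lebesgue" rule: ennreal_cases)
  case (real i)
  then show ?thesis
    using that(2)[of i]
    by (simp add: rhs_term_def LN_norm_def epowr_ennreal max_def split: if_splits)
next
  case top
  then show ?thesis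
    using that(1) by (simp add: rhs_term_def LN_norm_def epowr_def)
qed

section \<open>The one-sided maximum principle\<close>

text \<open>
  Whichever of the two powers is the minimum, say \<open>\<kappa>\<^sup>r\<close>, the hypothesis reads \<open>\<kappa>\<^sup>r\<^sup>+\<^sup>1 \<le> Q n\<close>. Taking the
  root and using \<open>Q\<^sup>1\<^sup>/\<^sup>(\<^sup>r\<^sup>+\<^sup>1\<^sup>) \<le> max 1 Q\<close> leaves a factor independent of \<open>p\<close> and \<open>q\<close>.
\<close>

lemma solve_powr_inequality:
  fixes \<kappa> p q Q n :: real
  assumes "0 < \<kappa>" "0 < p" "0 < q" "0 \<le> Q" "0 \<le> n" and le: "\<kappa> \<le> Q / min (\<kappa> powr p) (\<kappa> powr q) * n"
  shows "\<kappa> \<le> max 1 Q * max (n powr (1 / (p + 1))) (n powr (1 / (q + 1)))"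
proof -
  have one: "\<kappa> \<le> max 1 Q * n powr (1 / (r + 1))" if r: "0 < r" and k: "\<kappa> * \<kappa> powr r \<le> Q * n" for r
  proof -
    have "\<kappa> = (\<kappa> powr (r + 1)) powr (1 / (r + 1))" using assms(1) r by (simp add: powr_powr)
    also have "\<dots> \<le> (Q * n) powr (1 / (r + 1))"
      using k r assms by (intro powr_mono2) (auto simp: powr_add mult.commute)
    also have "\<dots> = Q powr (1 / (r + 1)) * n powr (1 / (r + 1))" using assms by (simp add: powr_mult)
    also have "\<dots> \<le> max 1 Q * n powr (1 / (r + 1))"
    proof (rule mult_right_mono)
      have "Q powr (1 / (r + 1)) \<le> max 1 Q powr (1 / (r + 1))"
        using assms r by (intro powr_mono2) auto
      also have "\<dots> \<le> max 1 Q powr 1" using r by (intro powr_mono) auto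
      finally show "Q powr (1 / (r + 1)) \<le> max 1 Q" by simp
    qed simp
    finally show ?thesis .
  qed
  let ?m = "min (\<kappa> powr p) (\<kappa> powr q)"
  have "?m > 0" using assms by simp
  then have "\<kappa> * ?m \<le> Q * n" using le by (simp add: field_simps)
  then have "\<kappa> * \<kappa> powr p \<le> Q * n \<or> \<kappa> * \<kappa> powr q \<le> Q * n" by (auto simp: min_def split: if_splits)
  then obtain r where r: "r = p \<or> r = q" "\<kappa> \<le> max 1 Q * n powr (1 / (r + 1))"
    using one assms by metis
  have "max 1 Q * n powr (1 / (r + 1)) \<le> max 1 Q * max (n powr (1 / (p + 1))) (n powr (1 / (q + 1)))"
    using r(1) by (intro mult_left_mono) auto
  with r(2) show ?thesis by linarith
qed

text \<open>
  The barrier contributes \<open>8 / (lam L1)\<close>; \<open>sqrt N\<close> is the ratio of the diameter of a cube to its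
  edge; the factor 4 relates the largest slope \<open>4 \<kappa>\<close> to \<open>\<kappa>\<close>; and the maximum with 1 comes from
  extracting roots.
\<close>

definition abp_constant :: "'n::finite itself \<Rightarrow> real \<Rightarrow> real \<Rightarrow> real" where
  "abp_constant n lam L1 = 4 * max 1 (8 * sqrt (real CARD('n)) / (lam * L1))"

text \<open>
  Both one-sided estimates are instances: the viscosity property is assumed only in the form in which sub-solutions and
  negated super-solutions share it, namely for quadratic test functions and with \<open>F\<close> replaced by its
  upper bound. If \<open>u x\<close> violated the estimate at some point, a number
  \<open>\<kappa>\<close> could be chosen strictly between the two sides (scaled by \<open>4 diam \<Omega>\<close>), contradicting the volume bound.
\<close>

lemma one_sided_bound:
  fixes u f a :: "real^'n \<Rightarrow> real" and H :: "real^'n \<Rightarrow> real^'n \<Rightarrow> real"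
  assumes lam: "0 < lam" "0 < Lam" and L1: "0 < L1" and pq: "0 < p" "0 < q"
    and \<Omega>: "open \<Omega>" "bounded \<Omega>" "\<Omega> \<noteq> {}"
    and jets: "\<And>z \<xi> X. z \<in> \<Omega> \<Longrightarrow> 0 < u z \<Longrightarrow> X \<in> Sym \<Longrightarrow>
                 local_max_at (\<lambda>y. u y - quadratic_at z \<xi> X y) z \<Longrightarrow>
                 f z \<le> H z \<xi> * pucci_max lam Lam X"
    and H: "\<And>z \<xi>. z \<in> \<Omega> \<Longrightarrow> L1 * (norm \<xi> powr p + a z * norm \<xi> powr q) \<le> H z \<xi>"
    and a: "\<And>z. z \<in> \<Omega> \<Longrightarrow> 0 \<le> a z"
    and cont: "continuous_on (closure \<Omega>) u" "continuous_on \<Omega> f" "continuous_on \<Omega> a"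
  shows "(SUP x\<in>\<Omega>. ereal (pos_part u x)) \<le> (SUP x\<in>frontier \<Omega>. ereal (pos_part u x))
           + ereal (abp_constant TYPE('n) lam L1 * diameter \<Omega>) *
             rhs_term p q (upper_contact_set \<Omega> (pos_part u)) (\<lambda>x. neg_part f x / (1 + a x))"
proof -
  let ?C = "abp_constant TYPE('n) lam L1" and ?d = "diameter \<Omega>"
    and ?R = "rhs_term p q (upper_contact_set \<Omega> (pos_part u)) (\<lambda>x. neg_part f x / (1 + a x))"
  have C: "?C > 0" by (simp add: abp_constant_def)
  have d: "?d > 0"
  proof -
    obtain x e where e: "e > 0" "cball x e \<subseteq> \<Omega>" using \<Omega> by (meson ex_in_conv open_contains_cball)
    have "diameter (cball x e) \<le> ?d" using e \<Omega> by (intro diameter_subset)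
    then show ?thesis using e by (simp add: diameter_cball)
  qed
  have fc: "compact (frontier \<Omega>)" using \<Omega> by (simp add: compact_frontier_bounded)
  have fne: "frontier \<Omega> \<noteq> {}" using \<Omega> frontier_eq_empty not_bounded_UNIV by blast
  have "continuous_on (frontier \<Omega>) (pos_part u)"
    unfolding pos_part_def
    by (intro continuous_intros continuous_on_subset[OF cont(1)]) (auto simp: frontier_def)
  then obtain b where b: "b \<in> frontier \<Omega>" "\<And>y. y \<in> frontier \<Omega> \<Longrightarrow> pos_part u y \<le> pos_part u b"
    using continuous_attains_sup[OF fc fne] by blast
  define m where "m = pos_part u b"
  have m: "0 \<le> m" "\<And>y. y \<in> frontier \<Omega> \<Longrightarrow> u y \<le> m"
    using b(2) by (auto simp: m_def pos_part_def)
  have msup: "ereal m \<le> (SUP x\<in>frontier \<Omega>. ereal (pos_part u x))"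
    unfolding m_def using b(1) by (rule SUP_upper)
  have main: "ereal (pos_part u x) \<le> ereal m + ereal (?C * ?d) * ?R" if x: "x \<in> \<Omega>" for x
  proof (cases rule: rhs_term_cases[of p q "upper_contact_set \<Omega> (pos_part u)" "\<lambda>x. neg_part f x / (1 + a x)"])
    case 1
    then show ?thesis using C d by simp
  next
    case (2 i)
    define n where "n = i powr (1 / CARD('n))"
    define \<mu> where "\<mu> = max (n powr (1 / (p + 1))) (n powr (1 / (q + 1)))"
    have R: "?R = ereal \<mu>" using 2 by (simp add: \<mu>_def n_def)
    have n: "n \<ge> 0" "n ^ CARD('n) = i"
      using 2(1) powr_power[of i "1 / real CARD('n)" "CARD('n)"] by (cases "i = 0"; simp add: n_def)+
    have \<mu>: "\<mu> \<ge> 0" by (simp add: \<mu>_def le_max_iff_disj)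
    have "u x \<le> m + ?C * ?d * \<mu>"
    proof (rule ccontr)
      assume "\<not> ?thesis"
      then have "?C * \<mu> / 4 < (u x - m) / (4 * ?d)" using d by (simp add: field_simps)
      then obtain \<kappa> where \<kappa>: "?C * \<mu> / 4 < \<kappa>" "\<kappa> < (u x - m) / (4 * ?d)"
        using dense by blast
      have \<kappa>0: "\<kappa> > 0" using \<kappa>(1) C \<mu> by (smt (verit) divide_nonneg_nonneg mult_nonneg_nonneg)
      have \<kappa>d: "m + 4 * \<kappa> * ?d < u x" using \<kappa>(2) d by (simp add: field_simps)
      let ?mk = "min (\<kappa> powr p) (\<kappa> powr q)"
      have mk: "?mk > 0" using \<kappa>0 by simp
      have "\<kappa> ^ CARD('n) \<le> (8 / (lam * L1 * ?mk) * sqrt (real CARD('n))) ^ CARD('n) * i"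
        using contact_slopes_volume_bound[OF lam L1 pq \<Omega>(1,2) jets H a cont m x \<kappa>0 \<kappa>d 2(1,2)] by blast
      also have "\<dots> = (8 / (lam * L1 * ?mk) * sqrt (real CARD('n)) * n) ^ CARD('n)"
        by (simp only: power_mult_distrib n(2))
      also have "8 / (lam * L1 * ?mk) * sqrt (real CARD('n)) * n
          = 8 * sqrt (real CARD('n)) / (lam * L1) / ?mk * n" by simp
      finally have "\<kappa> ^ CARD('n) \<le> (8 * sqrt (real CARD('n)) / (lam * L1) / ?mk * n) ^ CARD('n)" .
      moreover have "0 \<le> 8 * sqrt (real CARD('n)) / (lam * L1) / ?mk * n"
        using mk lam(1) L1 n(1) by (intro mult_nonneg_nonneg divide_nonneg_pos) auto
      ultimately have "\<kappa> \<le> 8 * sqrt (real CARD('n)) / (lam * L1) / ?mk * n"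
        using \<kappa>0 by (simp only: power_mono_iff[OF less_imp_le] zero_less_card_finite)
      then have "\<kappa> \<le> max 1 (8 * sqrt (real CARD('n)) / (lam * L1)) * \<mu>"
        unfolding \<mu>_def using \<kappa>0 pq lam L1 n by (intro solve_powr_inequality) auto
      then show False using \<kappa>(1) by (simp add: abp_constant_def)
    qed
    moreover have "0 \<le> m + ?C * ?d * \<mu>" using m(1) C d \<mu> by simp
    ultimately show ?thesis by (simp add: R pos_part_def)
  qed
  show ?thesis
  proof (rule SUP_least)
    fix x assume "x \<in> \<Omega>"
    from main[OF this] show "ereal (pos_part u x) \<le> (SUP x\<in>frontier \<Omega>. ereal (pos_part u x)) + ereal (?C * ?d) * ?R"
      using add_right_mono[OF msup] by (rule order_trans)
  qed
qed

section \<open>Viscosity sub- and super-solutions\<close>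

lemma F_le_pucci_max:
  assumes "F_assumptions lam Lam \<Omega> F" "x \<in> \<Omega>" "X \<in> Sym"
  shows "pucci_min lam Lam X \<le> F x X" "F x X \<le> pucci_max lam Lam X"
proof -
  have "0 \<in> Sym" by (simp add: Sym_def transpose_def vec_eq_iff)
  then have "pucci_min lam Lam (X - 0) \<le> F x X - F x 0 \<and> F x X - F x 0 \<le> pucci_max lam Lam (X - 0)"
      "F x 0 = 0"
    using assms unfolding F_assumptions_def by blast+
  then show "pucci_min lam Lam X \<le> F x X" "F x X \<le> pucci_max lam Lam X" by simp_all
qed

lemma subsolution_jet:
  assumes sub: "viscosity_subsolution H F f V u" and z: "z \<in> V" "z \<in> \<Omega>" and X: "X \<in> Sym"
    and mx: "local_max_at (\<lambda>y. u y - quadratic_at z \<xi> X y) z"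
    and F: "F_assumptions lam Lam \<Omega> F" and H: "0 \<le> H z \<xi>"
  shows "f z \<le> H z \<xi> * pucci_max lam Lam X"
proof -
  have "f z \<le> H z (grad (quadratic_at z \<xi> X) z) * F z (hess (quadratic_at z \<xi> X) z)"
    using sub z(1) mx quadratic_at_C2[OF X, of V z \<xi>]
    unfolding viscosity_subsolution_def by blast
  also have "\<dots> = H z \<xi> * F z X" by (simp only: grad_quadratic_at[OF X] hess_quadratic_at[OF X])
  also have "\<dots> \<le> H z \<xi> * pucci_max lam Lam X"
    by (rule mult_left_mono[OF F_le_pucci_max(2)[OF F z(2) X] H])
  finally show ?thesis .
qed

text \<open>
  A function \<open>q\<close> touches \<open>- u\<close> from above exactly when \<open>- q\<close> touches \<open>u\<close> from below, and
  \<open>- F(x, - X)\<close> is bounded by the same Pucci operator as \<open>F(x, X)\<close>. Thus \<open>- u\<close> behaves like a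
  sub-solution for the right-hand side \<open>- f\<close> and the Hamiltonian \<open>H(x, - \<xi>)\<close>.
\<close>

lemma supersolution_jet:
  assumes sup: "viscosity_supersolution H F f V u" and z: "z \<in> V" "z \<in> \<Omega>" and X: "X \<in> Sym"
    and mx: "local_max_at (\<lambda>y. - u y - quadratic_at z \<xi> X y) z"
    and F: "F_assumptions lam Lam \<Omega> F" and H: "0 \<le> H z (- \<xi>)"
  shows "- f z \<le> H z (- \<xi>) * pucci_max lam Lam X"
proof -
  have X': "- X \<in> Sym" using X by (simp add: Sym_def transpose_def vec_eq_iff)
  have q: "quadratic_at z (- \<xi>) (- X) y = - quadratic_at z \<xi> X y" for y
  proof -
    have "(- X) *v v = - (X *v v)" for v
      by (simp add: matrix_vector_mult_def vec_eq_iff sum_negf)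
    then show ?thesis by (simp add: quadratic_at_def)
  qed
  have mn: "local_min_at (\<lambda>y. u y - quadratic_at z (- \<xi>) (- X) y) z"
    using mx unfolding local_max_at_def local_min_at_def q by (simp add: algebra_simps)
  have "H z (- \<xi>) * - pucci_max lam Lam X \<le> H z (- \<xi>) * F z (- X)"
    using mult_left_mono[OF F_le_pucci_max(1)[OF F z(2) X'] H] by (simp add: pucci_min_uminus)
  also have "\<dots> = H z (grad (quadratic_at z (- \<xi>) (- X)) z) * F z (hess (quadratic_at z (- \<xi>) (- X)) z)"
    by (simp only: grad_quadratic_at[OF X'] hess_quadratic_at[OF X'])
  also have "\<dots> \<le> f z"
    using sup z(1) mn quadratic_at_C2[OF X', of V z "- \<xi>"]
    unfolding viscosity_supersolution_def by blast
  finally show ?thesis by simp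
qed

theorem theorem8p6:
  fixes lam Lam p q L1 d :: real
  assumes "0 < lam" "lam \<le> Lam" "0 < p" "p \<le> q" "0 < L1"
  shows "\<exists>C>0. \<forall>(\<Omega> :: (real^'n) set) f F H a L2.
    open \<Omega> \<and> bounded \<Omega> \<and> \<Omega> \<noteq> {} \<and> diameter \<Omega> = d \<and> continuous_on \<Omega> f \<and>
    F_assumptions lam Lam \<Omega> F \<and> H_assumptions p q L1 L2 a \<Omega> H \<longrightarrow>
    (\<forall>u. continuous_on (closure \<Omega>) u \<and>
         viscosity_subsolution H F f {x\<in>\<Omega>. u x > 0} u \<longrightarrow>
         (SUP x\<in>\<Omega>. ereal (u x)) \<le> (SUP x\<in>frontier \<Omega>. ereal (pos_part u x))
           + ereal (C * diameter \<Omega>) *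
             rhs_term p q (upper_contact_set \<Omega> (pos_part u)) (\<lambda>x. neg_part f x / (1 + a x))) \<and>
    (\<forall>u. continuous_on (closure \<Omega>) u \<and>
         viscosity_supersolution H F f {x\<in>\<Omega>. u x < 0} u \<longrightarrow>
         (SUP x\<in>\<Omega>. ereal (neg_part u x)) \<le> (SUP x\<in>frontier \<Omega>. ereal (neg_part u x))
           + ereal (C * diameter \<Omega>) *
             rhs_term p q (upper_contact_set \<Omega> (neg_part u)) (\<lambda>x. pos_part f x / (1 + a x))) \<and>
    (\<forall>u. continuous_on (closure \<Omega>) u \<and> viscosity_solution H F f \<Omega> u \<longrightarrow>
         (SUP x\<in>\<Omega>. ereal \<bar>u x\<bar>) \<le> (SUP x\<in>frontier \<Omega>. ereal \<bar>u x\<bar>)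
           + ereal (C * diameter \<Omega>) * rhs_term p q \<Omega> (\<lambda>x. f x / (1 + a x)))"
proof -
  let ?C = "abp_constant TYPE('n) lam L1"
  have pos: "0 < lam" "0 < Lam" "0 < L1" "0 < p" "0 < q" using assms by auto
  have C: "?C > 0" by (simp add: abp_constant_def)
  \<comment> \<open>Below, \<open>V\<close> is the set \<open>{u > 0}\<close> for a sub-solution and \<open>\<Omega>\<close> for a solution.\<close>
  have upper: "(SUP x\<in>\<Omega>. ereal (pos_part u x)) \<le> (SUP x\<in>frontier \<Omega>. ereal (pos_part u x))
           + ereal (?C * diameter \<Omega>) *
             rhs_term p q (upper_contact_set \<Omega> (pos_part u)) (\<lambda>x. neg_part f x / (1 + a x))"
    if "open \<Omega>" "bounded \<Omega>" "\<Omega> \<noteq> {}" "continuous_on \<Omega> f" and F: "F_assumptions lam Lam \<Omega> F"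
      and H: "H_assumptions p q L1 L2 a \<Omega> H" and u: "continuous_on (closure \<Omega>) u"
      and sub: "viscosity_subsolution H F f V u" and V: "{x\<in>\<Omega>. u x > 0} \<subseteq> V"
    for \<Omega> V :: "(real^'n) set" and f F H a L2 u
  proof (rule one_sided_bound[where H = H and Lam = Lam])
    show "f z \<le> H z \<xi> * pucci_max lam Lam X"
      if z: "z \<in> \<Omega>" "0 < u z" and X: "X \<in> Sym" "local_max_at (\<lambda>y. u y - quadratic_at z \<xi> X y) z"
      for z \<xi> X
    proof (rule subsolution_jet[OF sub _ z(1) X F])
      show "z \<in> V" using V z by blast
      show "0 \<le> H z \<xi>" using H z by (simp add: H_assumptions_def)
    qed
  qed (use that pos in \<open>auto simp: H_assumptions_def\<close>)
  have lower: "(SUP x\<in>\<Omega>. ereal (neg_part u x)) \<le> (SUP x\<in>frontier \<Omega>. ereal (neg_part u x))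
           + ereal (?C * diameter \<Omega>) *
             rhs_term p q (upper_contact_set \<Omega> (neg_part u)) (\<lambda>x. pos_part f x / (1 + a x))"
    if "open \<Omega>" "bounded \<Omega>" "\<Omega> \<noteq> {}" "continuous_on \<Omega> f" and F: "F_assumptions lam Lam \<Omega> F"
      and H: "H_assumptions p q L1 L2 a \<Omega> H" and u: "continuous_on (closure \<Omega>) u"
      and sup: "viscosity_supersolution H F f V u" and V: "{x\<in>\<Omega>. u x < 0} \<subseteq> V"
    for \<Omega> V :: "(real^'n) set" and f F H a L2 u
  proof -
    have eq: "neg_part u = pos_part (\<lambda>x. - u x)" "pos_part f = neg_part (\<lambda>x. - f x)"
      by (auto simp: neg_part_def pos_part_def fun_eq_iff)
    show ?thesis
      unfolding eq
    proof (rule one_sided_bound[where H = "\<lambda>z \<xi>. H z (- \<xi>)" and Lam = Lam])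
      show "- f z \<le> H z (- \<xi>) * pucci_max lam Lam X"
        if z: "z \<in> \<Omega>" "0 < - u z" and X: "X \<in> Sym" "local_max_at (\<lambda>y. - u y - quadratic_at z \<xi> X y) z"
        for z \<xi> X
      proof (rule supersolution_jet[OF sup _ z(1) X F])
        show "z \<in> V" using V z by auto
        show "0 \<le> H z (- \<xi>)" using H z by (simp add: H_assumptions_def)
      qed
      show "L1 * (norm \<xi> powr p + a z * norm \<xi> powr q) \<le> H z (- \<xi>)" if "z \<in> \<Omega>" for z \<xi>
        using H that unfolding H_assumptions_def by (metis norm_minus_cancel)
    qed (use that pos in \<open>auto simp: H_assumptions_def intro!: continuous_intros\<close>)
  qed
  have two_sided: "(SUP x\<in>\<Omega>. ereal \<bar>u x\<bar>) \<le> (SUP x\<in>frontier \<Omega>. ereal \<bar>u x\<bar>)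
           + ereal (?C * diameter \<Omega>) * rhs_term p q \<Omega> (\<lambda>x. f x / (1 + a x))"
    if hyp: "open \<Omega>" "bounded \<Omega>" "\<Omega> \<noteq> {}" "continuous_on \<Omega> f" "F_assumptions lam Lam \<Omega> F"
      "H_assumptions p q L1 L2 a \<Omega> H" "continuous_on (closure \<Omega>) u"
      and sol: "viscosity_solution H F f \<Omega> u"
    for \<Omega> :: "(real^'n) set" and f F H a L2 u
  proof -
    have d: "diameter \<Omega> \<ge> 0" using hyp by (intro diameter_ge_0)
    have a: "0 \<le> a x" if "x \<in> \<Omega>" for x using hyp(6) that by (simp add: H_assumptions_def)
    let ?B = "(SUP x\<in>frontier \<Omega>. ereal \<bar>u x\<bar>)
           + ereal (?C * diameter \<Omega>) * rhs_term p q \<Omega> (\<lambda>x. f x / (1 + a x))"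
    have "rhs_term p q (upper_contact_set \<Omega> (pos_part u)) (\<lambda>x. neg_part f x / (1 + a x))
        \<le> rhs_term p q \<Omega> (\<lambda>x. f x / (1 + a x))"
      using a pos by (intro rhs_term_mono)
        (auto simp: upper_contact_set_def neg_part_def abs_divide intro!: divide_right_mono)
    moreover have "rhs_term p q (upper_contact_set \<Omega> (neg_part u)) (\<lambda>x. pos_part f x / (1 + a x))
        \<le> rhs_term p q \<Omega> (\<lambda>x. f x / (1 + a x))"
      using a pos by (intro rhs_term_mono)
        (auto simp: upper_contact_set_def pos_part_def abs_divide intro!: divide_right_mono)
    moreover have "(SUP x\<in>frontier \<Omega>. ereal (pos_part u x)) \<le> (SUP x\<in>frontier \<Omega>. ereal \<bar>u x\<bar>)"
      "(SUP x\<in>frontier \<Omega>. ereal (neg_part u x)) \<le> (SUP x\<in>frontier \<Omega>. ereal \<bar>u x\<bar>)"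
      by (auto simp: pos_part_def neg_part_def intro!: SUP_mono')
    ultimately have "(SUP x\<in>\<Omega>. ereal (pos_part u x)) \<le> ?B" "(SUP x\<in>\<Omega>. ereal (neg_part u x)) \<le> ?B"
      using upper[OF hyp, of \<Omega>] lower[OF hyp, of \<Omega>] sol C d
      by (auto simp: viscosity_solution_def intro!: add_mono ereal_mult_left_mono elim!: order_trans)
    moreover have "ereal \<bar>u x\<bar> = max (ereal (pos_part u x)) (ereal (neg_part u x))" for x
      by (auto simp: pos_part_def neg_part_def max_def)
    ultimately show ?thesis by (auto simp: SUP_le_iff)
  qed
  have "(SUP x\<in>\<Omega>. ereal (u x)) \<le> (SUP x\<in>\<Omega>. ereal (pos_part u x))" for u and \<Omega> :: "(real^'n) set"
    by (rule SUP_mono') (simp add: pos_part_def)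
  note positive_part = this
  show ?thesis
  proof (rule exI[of _ ?C], intro conjI C allI impI; elim conjE)
    fix \<Omega> :: "(real^'n) set" and f a u :: "real^'n \<Rightarrow> real" and F H and L2 :: real
    assume hyp: "open \<Omega>" "bounded \<Omega>" "\<Omega> \<noteq> {}" "continuous_on \<Omega> f" "F_assumptions lam Lam \<Omega> F"
      "H_assumptions p q L1 L2 a \<Omega> H" "continuous_on (closure \<Omega>) u"
    show "(SUP x\<in>\<Omega>. ereal (u x)) \<le> (SUP x\<in>frontier \<Omega>. ereal (pos_part u x))
           + ereal (?C * diameter \<Omega>) *
             rhs_term p q (upper_contact_set \<Omega> (pos_part u)) (\<lambda>x. neg_part f x / (1 + a x))"
      if "viscosity_subsolution H F f {x\<in>\<Omega>. u x > 0} u"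
      using positive_part upper[OF hyp that order.refl] by (rule order_trans)
    show "(SUP x\<in>\<Omega>. ereal (neg_part u x)) \<le> (SUP x\<in>frontier \<Omega>. ereal (neg_part u x))
           + ereal (?C * diameter \<Omega>) *
             rhs_term p q (upper_contact_set \<Omega> (neg_part u)) (\<lambda>x. pos_part f x / (1 + a x))"
      if "viscosity_supersolution H F f {x\<in>\<Omega>. u x < 0} u"
      using hyp that order.refl by (rule lower)
    show "(SUP x\<in>\<Omega>. ereal \<bar>u x\<bar>) \<le> (SUP x\<in>frontier \<Omega>. ereal \<bar>u x\<bar>)
           + ereal (?C * diameter \<Omega>) * rhs_term p q \<Omega> (\<lambda>x. f x / (1 + a x))"
      if "viscosity_solution H F f \<Omega> u"
      using hyp that by (rule two_sided)
  qed
qed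

end
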